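(* Let $(X,\mathcal{F},m)$ be a $\sigma$-finite measure space and let $\mathcal{E}:\mathrm{L}^2(X,m)\to[0,\infty]$ be a l.s.c. functional, not identically $+\infty$. Then $\mathcal{E}$ is a non-bilinear Dirichlet form if and only if, for all $f,g\in\mathrm{L}^2(X,m)$ and all $\alpha\in[0,\infty)$, $$\mathcal{E}(f\vee g)+\mathcal{E}(f\wedge g)\le \mathcal{E}(f)+\mathcal{E}(g)$$ and $$\mathcal{E}(H_\alpha(f,g))+\mathcal{E}(H_\alpha(g,f))\le \mathcal{E}(f)+\mathcal{E}(g).$$
   Context: $X$ is a nonempty set with a $\sigma$-algebra $\mathcal{F}$ and a $\sigma$-finite measure $m:\mathcal{F}\to[0,\infty]$; $\mathrm{L}^2(X,m)$ denotes real-valued square-integrable functions (up to $m$-null sets). L.s.c. means lower semicontinuous on $\mathrm{L}^2(X,m)$. $f\vee g$ and $f\wedge g$ are the pointwise maximum and minimum. For $f,g\in\mathrm{L}^2(X,m)$ and $\alpha\in[0,\infty)$, $H_\alpha(f,g)=(g-\alpha)\vee f\wedge(g+\alpha)$, that is, $$H_\alpha(f,g)(x)=\begin{cases} g(x)-\alpha & f(x)-g(x)<-\alpha,\\ f(x) & f(x)-g(x)\in[-\alpha,\alpha],\\ g(x)+\alpha & f(x)-g(x)>\alpha.\end{cases}$$ Semigroup: for a convex l.s.c. functional $\mathcal{E}:\mathrm{L}^2(X,m)\to[0,\infty]$, not identically $+\infty$, let $(T_t)_{t\ge0}$ be the semigroup of nonlinear operators on $\mathrm{L}^2(X,m)$ generated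 by $-\partial\mathcal{E}$, where $\partial$ denotes the subdifferential operator, via the differential equation $$\partial_t T_tf\in-\partial\mathcal{E}(T_tf)\quad\text{for all }t\in(0,\infty)\text{ and all } f\in\mathrm{L}^2(X,m),\qquad T_0f=f\quad\text{for all } f\in\mathrm{L}^2(X,m).$$ This equation is taken to be well-posed for all $f\in\mathrm{L}^2(X,m)$; its solution is called the gradient flow of $\mathcal{E}$ starting at $f$. Non-bilinear Dirichlet form: a non-negative l.s.c. functional $\mathcal{E}:\mathrm{L}^2(X,m)\to[0,\infty]$, not identically $+\infty$, that is convex and such that, for all $t\ge0$, the operator $T_t:\mathrm{L}^2(X,m)\to\mathrm{L}^2(X,m)$ satisfies: (1) (order preservation) $T_tf\le T_tg$ for all $f,g\in\mathrm{L}^2(X,m)$ with $f\le g$ (pointwise order up to a negligible set); (2) ($\mathrm{L}^\infty$-contraction) $\|T_tf-T_tg\|_\infty\le\|f-g\|_\infty$ for all $f,g\in\mathrm{L}^2(X,m)$. *)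

theory Defs
  imports "HOL-Analysis.Analysis" "HOL-Probability.Essential_Supremum"
begin

text \<open>
  Elements of \<open>L\<^sup>2(X, m)\<close> are represented by square-integrable functions; identification up to
  null sets is expressed by the seminorm \<open>l2_norm\<close> and by \<open>AE\<close>. A functional is a map
  \<open>E :: ('a \<Rightarrow> real) \<Rightarrow> ennreal\<close> of which only the values on \<open>L2 M\<close> matter. Lower semicontinuity for
  \<open>l2_norm\<close> (see \<open>l2_lsc\<close>) already forces \<open>E f = E g\<close> whenever \<open>f = g\<close> almost everywhere, because
  then \<open>l2_norm (f - g) = 0\<close>; so every \<open>E\<close> considered is a functional on classes of functions.
\<close>

definition L2 :: "'a measure \<Rightarrow> ('a \<Rightarrow> real) set" where
  "L2 M = {f \<in> borel_measurable M. integrable M (\<lambda>x. (f x)\<^sup>2)}"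

definition l2_inner :: "'a measure \<Rightarrow> ('a \<Rightarrow> real) \<Rightarrow> ('a \<Rightarrow> real) \<Rightarrow> real" where
  "l2_inner M f g = (LINT x|M. f x * g x)"

definition l2_norm :: "'a measure \<Rightarrow> ('a \<Rightarrow> real) \<Rightarrow> real" where
  "l2_norm M f = sqrt (l2_inner M f f)"

definition linf_norm :: "'a measure \<Rightarrow> ('a \<Rightarrow> real) \<Rightarrow> ennreal" where
  "linf_norm M f = esssup M (\<lambda>x. ennreal \<bar>f x\<bar>)"

definition l2_lsc :: "'a measure \<Rightarrow> (('a \<Rightarrow> real) \<Rightarrow> ennreal) \<Rightarrow> bool" where
  "l2_lsc M E \<longleftrightarrow>
     (\<forall>f\<in>L2 M. \<forall>c<E f. \<exists>\<delta>>0. \<forall>g\<in>L2 M. l2_norm M (\<lambda>x. g x - f x) < \<delta> \<longrightarrow> c < E g)"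

definition l2_proper :: "'a measure \<Rightarrow> (('a \<Rightarrow> real) \<Rightarrow> ennreal) \<Rightarrow> bool" where
  "l2_proper M E \<longleftrightarrow> (\<exists>f\<in>L2 M. E f \<noteq> \<infinity>)"

definition l2_convex :: "'a measure \<Rightarrow> (('a \<Rightarrow> real) \<Rightarrow> ennreal) \<Rightarrow> bool" where
  "l2_convex M E \<longleftrightarrow>
     (\<forall>f\<in>L2 M. \<forall>g\<in>L2 M. \<forall>t\<in>{0..1}.
        E (\<lambda>x. (1 - t) * f x + t * g x) \<le> ennreal (1 - t) * E f + ennreal t * E g)"

text \<open>For a proper \<open>E\<close> the subdifferential is empty at every \<open>f\<close> with \<open>E f = \<infinity>\<close>.\<close>

definition subdifferential ::
    "'a measure \<Rightarrow> (('a \<Rightarrow> real) \<Rightarrow> ennreal) \<Rightarrow> ('a \<Rightarrow> real) \<Rightarrow> ('a \<Rightarrow> real) set" where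
  "subdifferential M E f =
     {h \<in> L2 M. \<forall>g\<in>L2 M.
        enn2ereal (E f) + ereal (l2_inner M h (\<lambda>x. g x - f x)) \<le> enn2ereal (E g)}"

definition l2_tendsto ::
    "'a measure \<Rightarrow> (real \<Rightarrow> 'a \<Rightarrow> real) \<Rightarrow> ('a \<Rightarrow> real) \<Rightarrow> real filter \<Rightarrow> bool" where
  "l2_tendsto M u v F \<longleftrightarrow> ((\<lambda>s. l2_norm M (\<lambda>x. u s x - v x)) \<longlongrightarrow> 0) F"

definition has_l2_right_derivative ::
    "'a measure \<Rightarrow> (real \<Rightarrow> 'a \<Rightarrow> real) \<Rightarrow> ('a \<Rightarrow> real) \<Rightarrow> real \<Rightarrow> bool" where
  "has_l2_right_derivative M u v t \<longleftrightarrow>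
     l2_tendsto M (\<lambda>s x. (u s x - u t x) / (s - t)) v (at_right t)"

definition l2_closure :: "'a measure \<Rightarrow> ('a \<Rightarrow> real) set \<Rightarrow> ('a \<Rightarrow> real) set" where
  "l2_closure M D = {f \<in> L2 M. \<forall>e>0. \<exists>g\<in>D. l2_norm M (\<lambda>x. f x - g x) < e}"

definition l2_nearest_point ::
    "'a measure \<Rightarrow> ('a \<Rightarrow> real) set \<Rightarrow> ('a \<Rightarrow> real) \<Rightarrow> ('a \<Rightarrow> real) \<Rightarrow> bool" where
  "l2_nearest_point M C f p \<longleftrightarrow>
     p \<in> C \<and> (\<forall>g\<in>C. l2_norm M (\<lambda>x. f x - p x) \<le> l2_norm M (\<lambda>x. f x - g x))"

definition l2_domain :: "'a measure \<Rightarrow> (('a \<Rightarrow> real) \<Rightarrow> ennreal) \<Rightarrow> ('a \<Rightarrow> real) set" where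
  "l2_domain M E = {f \<in> L2 M. E f \<noteq> \<infinity>}"

text \<open>
  Two conventions in the differential equation \<open>\<partial>\<^sub>t u \<in> - \<partial>E(u)\<close>, \<open>u(0) = f\<close>:

  \<^item> The time derivative is the right derivative in \<open>L\<^sup>2\<close>. The inclusion is required for all
    \<open>t > 0\<close>, and a two-sided derivative need not exist for all \<open>t > 0\<close>: for \<open>E(r) = \<bar>r\<bar>\<close> on the real
    line the flow from \<open>1\<close> is \<open>max 0 (1 - t)\<close>.

  \<^item> The equation forces \<open>u(t)\<close> to lie in the domain of \<open>E\<close> for \<open>t > 0\<close>. If \<open>f\<close> is in the closure of
    the domain, the last condition below is continuity at \<open>0\<close>. If it is not, no solution is
    continuous at \<open>0\<close>; as usual the flow then starts from the projection of \<open>f\<close> onto the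
    closure of the domain, which is what the exponential formula
    \<open>u(t) = lim\<^sub>n (I + (t/n) \<partial>E)\<^bsup>-n\<^esup> f\<close> gives for every \<open>f\<close> in \<open>L\<^sup>2\<close>.
\<close>

definition gradient_flow ::
    "'a measure \<Rightarrow> (('a \<Rightarrow> real) \<Rightarrow> ennreal) \<Rightarrow> ('a \<Rightarrow> real) \<Rightarrow> (real \<Rightarrow> 'a \<Rightarrow> real) \<Rightarrow> bool" where
  "gradient_flow M E f u \<longleftrightarrow>
     (\<forall>t\<ge>0. u t \<in> L2 M) \<and>
     (AE x in M. u 0 x = f x) \<and>
     (\<forall>t>0. \<exists>v\<in>L2 M. has_l2_right_derivative M u v t \<and> (\<lambda>x. - v x) \<in> subdifferential M E (u t)) \<and>
     (\<forall>t>0. l2_tendsto M u (u t) (at t)) \<and>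
     (\<exists>p. l2_nearest_point M (l2_closure M (l2_domain M E)) f p \<and> l2_tendsto M u p (at_right 0))"

definition gradient_flow_well_posed :: "'a measure \<Rightarrow> (('a \<Rightarrow> real) \<Rightarrow> ennreal) \<Rightarrow> bool" where
  "gradient_flow_well_posed M E \<longleftrightarrow>
     (\<forall>f\<in>L2 M. (\<exists>u. gradient_flow M E f u) \<and>
        (\<forall>u v. gradient_flow M E f u \<and> gradient_flow M E f v \<longrightarrow>
           (\<forall>t\<ge>0. AE x in M. u t x = v t x)))"

text \<open>
  This is the operator \<open>T\<^sub>t\<close>. When the equation is well-posed, the choice operator only selects
  representatives modulo null sets.
\<close>

definition semigroup ::
    "'a measure \<Rightarrow> (('a \<Rightarrow> real) \<Rightarrow> ennreal) \<Rightarrow> real \<Rightarrow> ('a \<Rightarrow> real) \<Rightarrow> 'a \<Rightarrow> real" where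
  "semigroup M E t f = (SOME u. gradient_flow M E f u) t"

definition order_preserving_on_L2 ::
    "'a measure \<Rightarrow> (('a \<Rightarrow> real) \<Rightarrow> 'a \<Rightarrow> real) \<Rightarrow> bool" where
  "order_preserving_on_L2 M S \<longleftrightarrow>
     (\<forall>f\<in>L2 M. \<forall>g\<in>L2 M. (AE x in M. f x \<le> g x) \<longrightarrow> (AE x in M. S f x \<le> S g x))"

definition linf_contraction_on_L2 ::
    "'a measure \<Rightarrow> (('a \<Rightarrow> real) \<Rightarrow> 'a \<Rightarrow> real) \<Rightarrow> bool" where
  "linf_contraction_on_L2 M S \<longleftrightarrow>
     (\<forall>f\<in>L2 M. \<forall>g\<in>L2 M. linf_norm M (\<lambda>x. S f x - S g x) \<le> linf_norm M (\<lambda>x. f x - g x))"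

definition nonbilinear_dirichlet_form :: "'a measure \<Rightarrow> (('a \<Rightarrow> real) \<Rightarrow> ennreal) \<Rightarrow> bool" where
  "nonbilinear_dirichlet_form M E \<longleftrightarrow>
     l2_lsc M E \<and> l2_proper M E \<and> l2_convex M E \<and>
     (\<forall>t\<ge>0. order_preserving_on_L2 M (semigroup M E t) \<and>
             linf_contraction_on_L2 M (semigroup M E t))"

definition H :: "real \<Rightarrow> ('a \<Rightarrow> real) \<Rightarrow> ('a \<Rightarrow> real) \<Rightarrow> 'a \<Rightarrow> real" where
  "H \<alpha> f g = (\<lambda>x. if f x - g x < - \<alpha> then g x - \<alpha>
                  else if f x - g x \<le> \<alpha> then f x
                  else g x + \<alpha>)"

end

theory Submission
  imports Defs
begin

text \<open>
  Both halves of the definition of a Dirichlet form are instances of one statement. Let \<open>\<phi>(d)\<close> be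
  \<open>d\<close> minus its projection onto a closed interval \<open>K\<close> containing \<open>0\<close>; \<open>K = (-\<infinity>, 0]\<close> gives order
  preservation and \<open>\<or>\<close>, \<open>\<and>\<close>, while \<open>K = [-\<alpha>, \<alpha>]\<close> gives \<open>L\<^sup>\<infinity>\<close>-contraction and \<open>H\<^sub>\<alpha>\<close>. The claim is that
  \<open>f - g \<in> K\<close> is preserved by the flow if and only if \<open>E(f - \<phi>(f - g)) + E(g + \<phi>(f - g)) \<le> E(f) + E(g)\<close>.

  If the inequality holds, the subgradient inequalities at two flows \<open>u\<close>, \<open>v\<close>, tested with
  \<open>u - \<phi>(u - v)\<close> and \<open>v + \<phi>(u - v)\<close>, show that \<open>\<parallel>\<phi>(u - v)\<parallel>\<close> is nonincreasing. Conversely, start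
  the flow from \<open>y = f - \<phi>(f - g)/2\<close> and \<open>z = g + \<phi>(f - g)/2\<close>, the projection of \<open>(f, g)\<close> onto the
  invariant convex set \<open>{(a, b). a - b \<in> K}\<close>. If \<open>E(y) + E(z) > E(f) + E(g)\<close>, the flow would come strictly
  closer to \<open>(f, g)\<close> while staying in that set, which is absurd. This gives the inequality with
  \<open>\<phi>/2\<close>; applying it along the segments from \<open>f\<close> to \<open>f - \<phi>\<close> and from \<open>g\<close> to \<open>g + \<phi>\<close> and
  telescoping yields the full one.

  Convexity of \<open>E\<close> follows from the \<open>H\<^sub>\<alpha>\<close>-inequalities: replacing \<open>(f, g)\<close> by
  \<open>(H\<^sub>\<alpha>(f, g), H\<^sub>\<alpha>(g, f))\<close> keeps \<open>f + g\<close>, nowhere increases \<open>\<bar>f - g\<bar>\<close>, and makes it at most \<open>\<alpha>\<close>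
  wherever it was at most \<open>2\<alpha>\<close>. Iterating with halved \<open>\<alpha>\<close> drives both functions to \<open>(f + g)/2\<close>.
\<close>

subsection \<open>Square-integrable functions\<close>

lemma L2_measurable: "f \<in> L2 M \<Longrightarrow> f \<in> borel_measurable M"
  by (simp add: L2_def)

lemma L2_integrable_mult:
  assumes "f \<in> L2 M" "g \<in> L2 M"
  shows "integrable M (\<lambda>x. f x * g x)"
proof (rule Bochner_Integration.integrable_bound)
  show "integrable M (\<lambda>x. (f x)\<^sup>2 + (g x)\<^sup>2)"
    using assms by (simp add: L2_def)
  show "(\<lambda>x. f x * g x) \<in> borel_measurable M"
    using assms by (auto simp: L2_def)
  have "\<bar>a * b\<bar> \<le> a\<^sup>2 + b\<^sup>2" for a b :: real
  proof -
    have "2 * \<bar>a\<bar> * \<bar>b\<bar> \<le> a\<^sup>2 + b\<^sup>2"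
      using sum_squares_bound[of "\<bar>a\<bar>" "\<bar>b\<bar>"] by simp
    moreover have "0 \<le> \<bar>a\<bar> * \<bar>b\<bar>" by simp
    ultimately show ?thesis unfolding abs_mult by linarith
  qed
  then show "AE x in M. norm (f x * g x) \<le> norm ((f x)\<^sup>2 + (g x)\<^sup>2)"
    by simp
qed

lemma L2_bound:
  assumes "g \<in> L2 M" "f \<in> borel_measurable M" "AE x in M. \<bar>f x\<bar> \<le> \<bar>g x\<bar>"
  shows "f \<in> L2 M"
proof -
  have "integrable M (\<lambda>x. (f x)\<^sup>2)"
  proof (rule Bochner_Integration.integrable_bound)
    show "integrable M (\<lambda>x. (g x)\<^sup>2)" using assms by (simp add: L2_def)
    show "AE x in M. norm ((f x)\<^sup>2) \<le> norm ((g x)\<^sup>2)"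
      using assms(3) by eventually_elim (simp add: abs_le_square_iff)
  qed (use assms in auto)
  then show ?thesis using assms by (simp add: L2_def)
qed

lemma L2_add:
  assumes "f \<in> L2 M" "g \<in> L2 M"
  shows "(\<lambda>x. f x + g x) \<in> L2 M"
proof -
  have "integrable M (\<lambda>x. (f x)\<^sup>2 + (g x)\<^sup>2 + 2 * (f x * g x))"
    using assms L2_integrable_mult[OF assms] by (simp add: L2_def)
  moreover have "(\<lambda>x. (f x)\<^sup>2 + (g x)\<^sup>2 + 2 * (f x * g x)) = (\<lambda>x. (f x + g x)\<^sup>2)"
    by (auto simp: power2_sum)
  ultimately show ?thesis using assms by (auto simp: L2_def)
qed

lemma L2_cmult: "f \<in> L2 M \<Longrightarrow> (\<lambda>x. c * f x) \<in> L2 M" for c :: real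
  by (auto simp: L2_def power_mult_distrib)

lemma L2_uminus: "f \<in> L2 M \<Longrightarrow> (\<lambda>x. - f x) \<in> L2 M"
  by (simp add: L2_def)

lemma L2_diff: "f \<in> L2 M \<Longrightarrow> g \<in> L2 M \<Longrightarrow> (\<lambda>x. f x - g x) \<in> L2 M"
  using L2_add[of f M "\<lambda>x. - g x"] L2_uminus[of g M] by simp

lemma L2_divide: "f \<in> L2 M \<Longrightarrow> (\<lambda>x. f x / c) \<in> L2 M" for c :: real
  using L2_cmult[of f M "inverse c"] by (simp add: field_simps)

lemmas L2_intros = L2_add L2_diff L2_cmult L2_uminus L2_divide

section \<open>Inner product and norm\<close>

lemma l2_inner_commute: "l2_inner M f g = l2_inner M g f"
  by (simp add: l2_inner_def mult.commute)

lemma l2_inner_add_right: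
  "\<lbrakk>f \<in> L2 M; g \<in> L2 M; h \<in> L2 M\<rbrakk> \<Longrightarrow>
    l2_inner M f (\<lambda>x. g x + h x) = l2_inner M f g + l2_inner M f h"
  by (simp add: l2_inner_def distrib_left L2_integrable_mult)

lemma l2_inner_diff_right:
  "\<lbrakk>f \<in> L2 M; g \<in> L2 M; h \<in> L2 M\<rbrakk> \<Longrightarrow>
    l2_inner M f (\<lambda>x. g x - h x) = l2_inner M f g - l2_inner M f h"
  by (simp add: l2_inner_def right_diff_distrib L2_integrable_mult)

lemma l2_inner_cmult_right: "l2_inner M f (\<lambda>x. c * g x) = c * l2_inner M f g"
  by (simp add: l2_inner_def mult.left_commute[of _ c])

lemma l2_inner_uminus_right: "l2_inner M f (\<lambda>x. - g x) = - l2_inner M f g"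
  by (simp add: l2_inner_def)

lemma l2_inner_uminus_left: "l2_inner M (\<lambda>x. - f x) g = - l2_inner M f g"
  by (simp add: l2_inner_def)

lemma l2_inner_add_left:
  "\<lbrakk>f \<in> L2 M; g \<in> L2 M; h \<in> L2 M\<rbrakk> \<Longrightarrow>
    l2_inner M (\<lambda>x. f x + g x) h = l2_inner M f h + l2_inner M g h"
  by (simp add: l2_inner_def distrib_right L2_integrable_mult)

lemma l2_inner_diff_left:
  "\<lbrakk>f \<in> L2 M; g \<in> L2 M; h \<in> L2 M\<rbrakk> \<Longrightarrow>
    l2_inner M (\<lambda>x. f x - g x) h = l2_inner M f h - l2_inner M g h"
  by (simp add: l2_inner_def left_diff_distrib L2_integrable_mult)

lemma l2_inner_cmult_left: "l2_inner M (\<lambda>x. c * f x) g = c * l2_inner M f g"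
  by (simp add: l2_inner_def mult.assoc)

lemma l2_inner_self_nonneg: "0 \<le> l2_inner M f f"
  by (simp add: l2_inner_def)

lemma l2_norm_nonneg: "0 \<le> l2_norm M f"
  by (simp add: l2_norm_def l2_inner_self_nonneg)

lemma l2_norm_power2: "(l2_norm M f)\<^sup>2 = l2_inner M f f"
  by (simp add: l2_norm_def l2_inner_self_nonneg)

lemma l2_norm_power2_eq_integral: "(l2_norm M f)\<^sup>2 = (LINT x|M. (f x)\<^sup>2)"
  using l2_norm_power2[of M f] by (simp add: l2_inner_def power2_eq_square)

lemma l2_norm_cmult: "l2_norm M (\<lambda>x. c * f x) = \<bar>c\<bar> * l2_norm M f"
  by (simp add: l2_norm_def l2_inner_cmult_left l2_inner_cmult_right real_sqrt_mult
      mult.assoc[symmetric])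

lemma l2_norm_minus_commute: "l2_norm M (\<lambda>x. f x - g x) = l2_norm M (\<lambda>x. g x - f x)"
  using l2_norm_cmult[of M "-1" "\<lambda>x. g x - f x"] by simp

lemma l2_norm_power2_add:
  assumes "f \<in> L2 M" "g \<in> L2 M"
  shows "(l2_norm M (\<lambda>x. f x + g x))\<^sup>2 = (l2_norm M f)\<^sup>2 + 2 * l2_inner M f g + (l2_norm M g)\<^sup>2"
  using assms
  by (simp add: l2_norm_power2 l2_inner_add_left l2_inner_add_right L2_add l2_inner_commute[of M g f])

lemma l2_norm_power2_diff:
  assumes "f \<in> L2 M" "g \<in> L2 M"
  shows "(l2_norm M (\<lambda>x. f x - g x))\<^sup>2 = (l2_norm M f)\<^sup>2 - 2 * l2_inner M f g + (l2_norm M g)\<^sup>2"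
  using assms
  by (simp add: l2_norm_power2 l2_inner_diff_left l2_inner_diff_right L2_diff l2_inner_commute[of M g f])

lemma l2_norm_power2_add_cmult:
  assumes "f \<in> L2 M" "g \<in> L2 M"
  shows "(l2_norm M (\<lambda>x. f x + c * g x))\<^sup>2
    = (l2_norm M f)\<^sup>2 + 2 * c * l2_inner M f g + c\<^sup>2 * (l2_norm M g)\<^sup>2"
  unfolding l2_norm_power2_add[OF assms(1) L2_cmult[OF assms(2)]] l2_inner_cmult_right l2_norm_cmult
  by (simp add: power_mult_distrib)

lemma l2_norm_mono:
  assumes "g \<in> L2 M" "f \<in> borel_measurable M" "AE x in M. \<bar>f x\<bar> \<le> \<bar>g x\<bar>"
  shows "l2_norm M f \<le> l2_norm M g"
proof -
  have "(LINT x|M. f x * f x) \<le> (LINT x|M. g x * g x)"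
  proof (rule integral_mono_AE)
    show "AE x in M. f x * f x \<le> g x * g x"
      using assms(3) by eventually_elim (simp add: abs_le_square_iff flip: power2_eq_square)
  qed (rule L2_integrable_mult L2_bound[OF assms] assms(1))+
  then show ?thesis by (simp add: l2_norm_def l2_inner_def)
qed

lemma l2_norm_eq_0_iff:
  assumes "f \<in> L2 M"
  shows "l2_norm M f = 0 \<longleftrightarrow> (AE x in M. f x = 0)"
  using integral_nonneg_eq_0_iff_AE[of M "\<lambda>x. f x * f x"] L2_integrable_mult[OF assms assms]
  by (simp add: l2_norm_def l2_inner_def)

text \<open>The squared norm of \<open>f - t * g\<close> is a polynomial in \<open>t\<close> of
  degree at most two that is never negative, which bounds its discriminant.\<close>

lemma l2_Cauchy_Schwarz:
  assumes "f \<in> L2 M" "g \<in> L2 M"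
  shows "\<bar>l2_inner M f g\<bar> \<le> l2_norm M f * l2_norm M g"
proof -
  let ?a = "l2_norm M f" and ?b = "l2_norm M g" and ?i = "l2_inner M f g"
  have *: "0 \<le> ?a\<^sup>2 - 2 * t * ?i + t\<^sup>2 * ?b\<^sup>2" for t
  proof -
    have "0 \<le> (l2_norm M (\<lambda>x. f x - t * g x))\<^sup>2" by simp
    also have "\<dots> = ?a\<^sup>2 - 2 * t * ?i + t\<^sup>2 * ?b\<^sup>2"
      using assms by (simp add: l2_norm_power2_diff L2_cmult l2_inner_cmult_right l2_norm_cmult
          power_mult_distrib)
    finally show ?thesis .
  qed
  have "?i\<^sup>2 \<le> ?a\<^sup>2 * ?b\<^sup>2"
  proof (cases "?b = 0")
    case True
    have "?i = 0"
    proof (rule ccontr)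
      assume "?i \<noteq> 0"
      \<comment> \<open>Without its quadratic term the polynomial is affine in \<open>t\<close>; at
        the chosen \<open>t\<close> it equals -1.\<close>
      then show False
        using *[of "(?a\<^sup>2 + 1) / (2 * ?i)"] True by simp
    qed
    then show ?thesis by simp
  next
    case False
    then have "0 < ?b\<^sup>2" by simp
    \<comment> \<open>The minimiser of the polynomial.\<close>
    define t where "t = ?i / ?b\<^sup>2"
    have t: "?i = t * ?b\<^sup>2" using \<open>0 < ?b\<^sup>2\<close> by (simp add: t_def)
    have "t\<^sup>2 * ?b\<^sup>2 \<le> ?a\<^sup>2"
      using *[of t] unfolding t by (simp add: power2_eq_square algebra_simps)
    then have "t\<^sup>2 * ?b\<^sup>2 * ?b\<^sup>2 \<le> ?a\<^sup>2 * ?b\<^sup>2"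
      by (rule mult_right_mono) simp
    then show ?thesis unfolding t by (simp add: power2_eq_square algebra_simps)
  qed
  then have "?i\<^sup>2 \<le> (?a * ?b)\<^sup>2" by (simp add: power_mult_distrib)
  then show ?thesis
    by (simp add: abs_le_square_iff[symmetric] abs_mult l2_norm_nonneg)
qed

lemma l2_norm_triangle:
  assumes "f \<in> L2 M" "g \<in> L2 M"
  shows "l2_norm M (\<lambda>x. f x + g x) \<le> l2_norm M f + l2_norm M g"
proof (rule power2_le_imp_le)
  show "(l2_norm M (\<lambda>x. f x + g x))\<^sup>2 \<le> (l2_norm M f + l2_norm M g)\<^sup>2"
    using l2_Cauchy_Schwarz[OF assms] assms
    by (simp add: l2_norm_power2_add power2_sum)
qed (simp add: l2_norm_nonneg)

lemma l2_norm_diff_le: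
  assumes "f \<in> L2 M" "g \<in> L2 M"
  shows "\<bar>l2_norm M f - l2_norm M g\<bar> \<le> l2_norm M (\<lambda>x. f x - g x)"
  using l2_norm_triangle[of "\<lambda>x. f x - g x" M g] l2_norm_triangle[of "\<lambda>x. g x - f x" M f]
    l2_norm_minus_commute[of M f g] assms
  by (simp add: L2_diff)

lemma l2_norm_diff_diff_le:
  assumes "f \<in> L2 M" "g \<in> L2 M" "f' \<in> L2 M" "g' \<in> L2 M"
  shows "l2_norm M (\<lambda>x. (f x - g x) - (f' x - g' x))
    \<le> l2_norm M (\<lambda>x. f x - f' x) + l2_norm M (\<lambda>x. g x - g' x)"
proof -
  have "l2_norm M (\<lambda>x. (f x - g x) - (f' x - g' x)) = l2_norm M (\<lambda>x. (f x - f' x) + (g' x - g x))"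
    by (simp add: algebra_simps)
  also have "\<dots> \<le> l2_norm M (\<lambda>x. f x - f' x) + l2_norm M (\<lambda>x. g' x - g x)"
    using assms by (intro l2_norm_triangle L2_intros)
  finally show ?thesis by (simp add: l2_norm_minus_commute[of M g' g])
qed

section \<open>Convergence in norm and lower semicontinuity\<close>

lemma tendsto_l2_norm:
  assumes "eventually (\<lambda>s. u s \<in> L2 M) F" "z \<in> L2 M"
    and "((\<lambda>s. l2_norm M (\<lambda>x. u s x - z x)) \<longlongrightarrow> 0) F"
  shows "((\<lambda>s. l2_norm M (u s)) \<longlongrightarrow> l2_norm M z) F"
proof (rule LIM_zero_cancel, rule Lim_null_comparison[OF _ assms(3)])
  show "\<forall>\<^sub>F s in F. norm (l2_norm M (u s) - l2_norm M z) \<le> l2_norm M (\<lambda>x. u s x - z x)"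
    using assms(1) by eventually_elim (simp add: l2_norm_diff_le assms(2))
qed

lemma tendsto_l2_norm_diff:
  assumes "eventually (\<lambda>s. u s \<in> L2 M) F" "z \<in> L2 M" "f \<in> L2 M"
    and "((\<lambda>s. l2_norm M (\<lambda>x. u s x - z x)) \<longlongrightarrow> 0) F"
  shows "((\<lambda>s. l2_norm M (\<lambda>x. u s x - f x)) \<longlongrightarrow> l2_norm M (\<lambda>x. z x - f x)) F"
proof (rule tendsto_l2_norm)
  show "\<forall>\<^sub>F s in F. (\<lambda>x. u s x - f x) \<in> L2 M"
    using assms(1) by eventually_elim (simp add: L2_diff assms)
qed (use assms in \<open>auto intro: L2_diff\<close>)

lemma tendsto_l2_diff_diff:
  assumes "eventually (\<lambda>s. u s \<in> L2 M) F" "eventually (\<lambda>s. v s \<in> L2 M) F" "y \<in> L2 M" "z \<in> L2 M"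
    and "((\<lambda>s. l2_norm M (\<lambda>x. u s x - y x)) \<longlongrightarrow> 0) F"
    and "((\<lambda>s. l2_norm M (\<lambda>x. v s x - z x)) \<longlongrightarrow> 0) F"
  shows "((\<lambda>s. l2_norm M (\<lambda>x. (u s x - v s x) - (y x - z x))) \<longlongrightarrow> 0) F"
proof (rule Lim_null_comparison)
  show "\<forall>\<^sub>F s in F. norm (l2_norm M (\<lambda>x. (u s x - v s x) - (y x - z x)))
      \<le> l2_norm M (\<lambda>x. u s x - y x) + l2_norm M (\<lambda>x. v s x - z x)"
    using assms(1,2)
    by eventually_elim (simp add: l2_norm_diff_diff_le assms(3,4) l2_norm_nonneg)
  show "((\<lambda>s. l2_norm M (\<lambda>x. u s x - y x) + l2_norm M (\<lambda>x. v s x - z x)) \<longlongrightarrow> 0) F"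
    using tendsto_add[OF assms(5,6)] by simp
qed

lemma tendsto_l2_inner:
  assumes "eventually (\<lambda>s. u s \<in> L2 M) F" "z \<in> L2 M" "f \<in> L2 M"
    and "((\<lambda>s. l2_norm M (\<lambda>x. u s x - z x)) \<longlongrightarrow> 0) F"
  shows "((\<lambda>s. l2_inner M f (u s)) \<longlongrightarrow> l2_inner M f z) F"
proof (rule LIM_zero_cancel, rule Lim_null_comparison)
  show "\<forall>\<^sub>F s in F. norm (l2_inner M f (u s) - l2_inner M f z)
      \<le> l2_norm M f * l2_norm M (\<lambda>x. u s x - z x)"
    using assms(1)
  proof eventually_elim
    case (elim s)
    then show ?case
      using l2_Cauchy_Schwarz[of f M "\<lambda>x. u s x - z x"] assms
      by (simp add: L2_diff l2_inner_diff_right)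
  qed
  show "((\<lambda>s. l2_norm M f * l2_norm M (\<lambda>x. u s x - z x)) \<longlongrightarrow> 0) F"
    using tendsto_mult_left[OF assms(4), of "l2_norm M f"] by simp
qed

text \<open>Replacing \<open>E (u s)\<close> by its minimum with \<open>E y\<close> turns lower
  semicontinuity into convergence, so the two limits can be added in \<open>ennreal\<close>,
  infinite values included.\<close>

lemma l2_lsc_eventually_add:
  assumes "l2_lsc M E" "y \<in> L2 M" "z \<in> L2 M"
    and "eventually (\<lambda>s. u s \<in> L2 M) F" "eventually (\<lambda>s. v s \<in> L2 M) F"
    and "((\<lambda>s. l2_norm M (\<lambda>x. u s x - y x)) \<longlongrightarrow> 0) F"
    and "((\<lambda>s. l2_norm M (\<lambda>x. v s x - z x)) \<longlongrightarrow> 0) F"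
    and "c < E y + E z"
  shows "eventually (\<lambda>s. c < E (u s) + E (v s)) F"
proof -
  have min_tendsto: "((\<lambda>s. min (E (u s)) (E y)) \<longlongrightarrow> E y) F"
    if "y \<in> L2 M" "eventually (\<lambda>s. u s \<in> L2 M) F"
      "((\<lambda>s. l2_norm M (\<lambda>x. u s x - y x)) \<longlongrightarrow> 0) F" for u y
  proof (rule order_tendstoI)
    fix a assume "a < E y"
    then obtain \<delta> where "\<delta> > 0" and \<delta>: "\<And>g. g \<in> L2 M \<Longrightarrow> l2_norm M (\<lambda>x. g x - y x) < \<delta> \<Longrightarrow> a < E g"
      using assms(1) \<open>y \<in> L2 M\<close> unfolding l2_lsc_def by blast
    have "eventually (\<lambda>s. l2_norm M (\<lambda>x. u s x - y x) < \<delta>) F"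
      using order_tendstoD(2)[OF that(3) \<open>\<delta> > 0\<close>] .
    with that(2) show "eventually (\<lambda>s. a < min (E (u s)) (E y)) F"
      by eventually_elim (use \<delta> \<open>a < E y\<close> in auto)
  next
    fix a assume "E y < a"
    then show "eventually (\<lambda>s. min (E (u s)) (E y) < a) F"
      by (simp add: min_less_iff_disj)
  qed
  have "((\<lambda>s. min (E (u s)) (E y) + min (E (v s)) (E z)) \<longlongrightarrow> E y + E z) F"
    by (intro tendsto_add min_tendsto assms)
  then have "eventually (\<lambda>s. c < min (E (u s)) (E y) + min (E (v s)) (E z)) F"
    using assms(8) by (rule order_tendstoD(1))
  then show ?thesis
    by eventually_elim (meson add_mono min.cobounded1 order_less_le_trans)
qed

text \<open>Flows are only differentiable from the right, so monotonicity has to come from upper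
  bounds on right difference quotients. For each \<open>e > 0\<close> the set \<open>S\<close> of
  points where \<open>h\<close> has grown at average rate at most \<open>e\<close> is closed; a
  largest element below \<open>b\<close> could be moved further right.\<close>

lemma real_le_of_right_slope_nonpos:
  fixes h :: "real \<Rightarrow> real"
  assumes "a \<le> b" "continuous_on {a..b} h"
    and slope: "\<And>t. a \<le> t \<Longrightarrow> t < b \<Longrightarrow>
      \<exists>q l. (q \<longlongrightarrow> l) (at_right t) \<and> l \<le> 0 \<and> eventually (\<lambda>s. h s - h t \<le> (s - t) * q s) (at_right t)"
  shows "h b \<le> h a"
proof (rule field_le_epsilon)
  fix e' :: real assume "e' > 0"
  \<comment> \<open>The total error \<open>e * (b - a)\<close> is then at most \<open>e'\<close>;
    the summand 1 keeps the denominator positive when \<open>a = b\<close>.\<close>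
  define e where "e = e' / (b - a + 1)"
  have "e > 0" using \<open>e' > 0\<close> \<open>a \<le> b\<close> by (simp add: e_def)
  define S where "S = {t \<in> {a..b}. h t - e * t \<le> h a - e * a}"
  have "closed S"
    unfolding S_def
    by (rule continuous_on_closed_Collect_le) (auto intro!: continuous_intros assms)
  have "a \<in> S" using \<open>a \<le> b\<close> by (simp add: S_def)
  have "bdd_above S" unfolding S_def by auto
  define c where "c = Sup S"
  have "c \<in> S" unfolding c_def
    using \<open>closed S\<close> \<open>a \<in> S\<close> \<open>bdd_above S\<close> by (intro closed_contains_Sup) auto
  have "c = b"
  proof (rule ccontr)
    assume "c \<noteq> b"
    then have c: "a \<le> c" "c < b" using \<open>c \<in> S\<close> by (auto simp: S_def)
    from slope[OF c] obtain q l where q: "(q \<longlongrightarrow> l) (at_right c)" "l \<le> 0"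
      "eventually (\<lambda>s. h s - h c \<le> (s - c) * q s) (at_right c)" by blast
    have "eventually (\<lambda>s. q s < e) (at_right c)"
      using q(1) by (rule order_tendstoD(2)) (use q(2) \<open>e > 0\<close> in linarith)
    with q(3) have "eventually (\<lambda>s. h s - h c \<le> (s - c) * q s \<and> q s < e) (at_right c)"
      by (rule eventually_conj)
    then obtain d where "d > c" and d: "\<And>s. c < s \<Longrightarrow> s < d \<Longrightarrow> h s - h c \<le> (s - c) * q s \<and> q s < e"
      unfolding eventually_at_right_field by blast
    define s where "s = (c + min d b) / 2"
    have s: "c < s" "s < d" "s < b" using \<open>d > c\<close> \<open>c < b\<close> by (auto simp: s_def)
    have "(s - c) * q s \<le> (s - c) * e"
      using d[OF s(1,2)] s(1) by (intro mult_left_mono) auto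
    then have "h s - h c \<le> (s - c) * e" using d[OF s(1,2)] by linarith
    then have "s \<in> S" using \<open>c \<in> S\<close> s c by (simp add: S_def algebra_simps)
    then have "s \<le> c" unfolding c_def using \<open>bdd_above S\<close> by (rule cSup_upper)
    then show False using s by simp
  qed
  then have "h b \<le> h a + e * (b - a)" using \<open>c \<in> S\<close> by (simp add: S_def algebra_simps)
  also have "e * (b - a) \<le> e'"
    using \<open>e' > 0\<close> \<open>a \<le> b\<close> by (simp add: e_def field_simps)
  finally show "h b \<le> h a + e'" by simp
qed

subsection \<open>Truncations and convex functionals\<close>

text \<open>The assumption \<open>subgradient\<close> says that \<open>\<phi>(b)\<close> is a subgradient at \<open>b\<close> of the convex function \<open>\<phi>\<^sup>2/2\<close>.\<close>

locale soft_truncation =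
  fixes \<phi> :: "real \<Rightarrow> real"
  assumes zero [simp]: "\<phi> 0 = 0"
    and lipschitz: "\<bar>\<phi> a - \<phi> b\<bar> \<le> \<bar>a - b\<bar>"
    and subgradient: "(\<phi> b)\<^sup>2 / 2 + \<phi> b * (a - b) \<le> (\<phi> a)\<^sup>2 / 2"
    and scaling: "0 \<le> r \<Longrightarrow> r \<le> 1 \<Longrightarrow> \<phi> (a - r * \<phi> a) = (1 - r) * \<phi> a"
begin

lemma measurable: "\<phi> \<in> borel_measurable borel"
proof (rule borel_measurable_continuous_onI, rule continuous_at_imp_continuous_on, rule ballI)
  fix a
  show "isCont \<phi> a"
    unfolding isCont_def
    by (rule LIM_zero_cancel, rule Lim_null_comparison[where g = "\<lambda>b. \<bar>b - a\<bar>"])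
      (auto intro!: always_eventually tendsto_eq_intros lipschitz)
qed

lemma L2_comp:
  assumes "f \<in> L2 M"
  shows "(\<lambda>x. \<phi> (f x)) \<in> L2 M"
proof (rule L2_bound[OF assms])
  show "(\<lambda>x. \<phi> (f x)) \<in> borel_measurable M"
    using measurable L2_measurable[OF assms] by (rule measurable_compose[rotated])
qed (use lipschitz[of _ 0] in simp)

lemma norm_comp_diff_le:
  assumes "f \<in> L2 M" "g \<in> L2 M"
  shows "l2_norm M (\<lambda>x. \<phi> (f x) - \<phi> (g x)) \<le> l2_norm M (\<lambda>x. f x - g x)"
  by (rule l2_norm_mono)
    (auto intro!: lipschitz L2_diff L2_comp L2_measurable assms)

lemma tendsto_norm_comp:
  assumes "eventually (\<lambda>s. w s \<in> L2 M) F" "z \<in> L2 M"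
    and "((\<lambda>s. l2_norm M (\<lambda>x. w s x - z x)) \<longlongrightarrow> 0) F"
  shows "((\<lambda>s. l2_norm M (\<lambda>x. \<phi> (w s x))) \<longlongrightarrow> l2_norm M (\<lambda>x. \<phi> (z x))) F"
proof (rule tendsto_l2_norm)
  show "\<forall>\<^sub>F s in F. (\<lambda>x. \<phi> (w s x)) \<in> L2 M"
    using assms(1) by eventually_elim (rule L2_comp)
  show "((\<lambda>s. l2_norm M (\<lambda>x. \<phi> (w s x) - \<phi> (z x))) \<longlongrightarrow> 0) F"
  proof (rule Lim_null_comparison[OF _ assms(3)])
    show "\<forall>\<^sub>F s in F. norm (l2_norm M (\<lambda>x. \<phi> (w s x) - \<phi> (z x))) \<le> l2_norm M (\<lambda>x. w s x - z x)"
      using assms(1) by eventually_elim (simp add: l2_norm_nonneg norm_comp_diff_le assms(2))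
  qed
qed (rule L2_comp[OF assms(2)])

text \<open>Makes the shifted function depend continuously on \<open>a\<close>, \<open>f\<close> and
  \<open>g\<close>, so that shifts of points in the closure of the domain are approximated by shifts
  of points in the domain.\<close>

lemma norm_shift_diff_le:
  assumes "a \<in> L2 M" "a' \<in> L2 M" "f \<in> L2 M" "f' \<in> L2 M" "g \<in> L2 M" "g' \<in> L2 M"
  shows "l2_norm M (\<lambda>x. (a x - c * \<phi> (f x - g x)) - (a' x - c * \<phi> (f' x - g' x)))
    \<le> l2_norm M (\<lambda>x. a x - a' x)
      + \<bar>c\<bar> * (l2_norm M (\<lambda>x. f x - f' x) + l2_norm M (\<lambda>x. g x - g' x))"
proof -
  have L: "(\<lambda>x. \<phi> (f x - g x)) \<in> L2 M" "(\<lambda>x. \<phi> (f' x - g' x)) \<in> L2 M"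
    using assms by (auto intro: L2_comp L2_diff)
  have "l2_norm M (\<lambda>x. (a x - c * \<phi> (f x - g x)) - (a' x - c * \<phi> (f' x - g' x)))
    \<le> l2_norm M (\<lambda>x. a x - a' x) + l2_norm M (\<lambda>x. c * \<phi> (f x - g x) - c * \<phi> (f' x - g' x))"
    using assms L by (intro l2_norm_diff_diff_le L2_cmult)
  also have "l2_norm M (\<lambda>x. c * \<phi> (f x - g x) - c * \<phi> (f' x - g' x))
      = \<bar>c\<bar> * l2_norm M (\<lambda>x. \<phi> (f x - g x) - \<phi> (f' x - g' x))"
    by (simp add: right_diff_distrib flip: l2_norm_cmult)
  also have "\<dots> \<le> \<bar>c\<bar> * l2_norm M (\<lambda>x. (f x - g x) - (f' x - g' x))"
    using assms by (intro mult_left_mono norm_comp_diff_le L2_diff) auto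
  also have "\<dots> \<le> \<bar>c\<bar> * (l2_norm M (\<lambda>x. f x - f' x) + l2_norm M (\<lambda>x. g x - g' x))"
    using assms by (intro mult_left_mono l2_norm_diff_diff_le) auto
  finally show ?thesis by simp
qed

text \<open>The integrated form of \<open>subgradient\<close>. It serves both the comparison of
  nearest points and the slope bound along two flows.\<close>

lemma norm_comp_power2_le:
  assumes "a \<in> L2 M" "b \<in> L2 M"
  shows "(l2_norm M (\<lambda>x. \<phi> (b x)))\<^sup>2 / 2 + l2_inner M (\<lambda>x. \<phi> (b x)) (\<lambda>x. a x - b x)
    \<le> (l2_norm M (\<lambda>x. \<phi> (a x)))\<^sup>2 / 2"
proof -
  have int: "integrable M (\<lambda>x. (\<phi> (c x))\<^sup>2)" if "c \<in> L2 M" for c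
    using L2_comp[OF that] by (simp add: L2_def)
  have int': "integrable M (\<lambda>x. \<phi> (b x) * (a x - b x))"
    using assms by (intro L2_integrable_mult L2_comp L2_diff)
  have "(l2_norm M (\<lambda>x. \<phi> (b x)))\<^sup>2 / 2 + l2_inner M (\<lambda>x. \<phi> (b x)) (\<lambda>x. a x - b x)
      = (LINT x|M. (\<phi> (b x))\<^sup>2 / 2 + \<phi> (b x) * (a x - b x))"
    using int[OF assms(2)] int' by (simp add: l2_norm_power2_eq_integral l2_inner_def)
  also have "\<dots> \<le> (LINT x|M. (\<phi> (a x))\<^sup>2 / 2)"
    using int int' assms by (intro integral_mono subgradient) auto
  also have "\<dots> = (l2_norm M (\<lambda>x. \<phi> (a x)))\<^sup>2 / 2"
    by (simp add: l2_norm_power2_eq_integral)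
  finally show ?thesis .
qed

end

section \<open>Convex functionals: domain, subgradients and nearest points\<close>

lemma l2_closure_subset: "l2_closure M D \<subseteq> L2 M"
  by (auto simp: l2_closure_def)

locale convex_l2_functional =
  fixes M :: "'a measure" and E :: "('a \<Rightarrow> real) \<Rightarrow> ennreal"
  assumes lsc: "l2_lsc M E" and proper: "l2_proper M E" and convex: "l2_convex M E"
begin

lemma domain_L2: "f \<in> l2_domain M E \<Longrightarrow> f \<in> L2 M"
  by (simp add: l2_domain_def)

lemma E_eq_ennreal: "f \<in> l2_domain M E \<Longrightarrow> E f = ennreal (enn2real (E f))"
  by (simp add: l2_domain_def top.not_eq_extremum)

lemma domain_convex:
  assumes "f \<in> l2_domain M E" "g \<in> l2_domain M E" "0 \<le> t" "t \<le> 1"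
  shows "(\<lambda>x. (1 - t) * f x + t * g x) \<in> l2_domain M E"
    and "enn2real (E (\<lambda>x. (1 - t) * f x + t * g x)) \<le> (1 - t) * enn2real (E f) + t * enn2real (E g)"
proof -
  have "E (\<lambda>x. (1 - t) * f x + t * g x) \<le> ennreal (1 - t) * E f + ennreal t * E g"
    using convex assms by (auto simp: l2_convex_def l2_domain_def)
  also have "\<dots> = ennreal ((1 - t) * enn2real (E f) + t * enn2real (E g))"
    using assms
    by (cases "E f"; cases "E g") (auto simp: l2_domain_def simp flip: ennreal_mult ennreal_plus)
  finally have *: "E (\<lambda>x. (1 - t) * f x + t * g x)
      \<le> ennreal ((1 - t) * enn2real (E f) + t * enn2real (E g))" .
  then show "(\<lambda>x. (1 - t) * f x + t * g x) \<in> l2_domain M E"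
    using assms by (auto simp: l2_domain_def top_unique intro!: L2_intros)
  show "enn2real (E (\<lambda>x. (1 - t) * f x + t * g x)) \<le> (1 - t) * enn2real (E f) + t * enn2real (E g)"
    using assms * by (intro enn2real_leI) auto
qed

text \<open>If \<open>E u\<close> were infinite, the subgradient inequality would make
  \<open>E\<close> infinite everywhere, against properness.\<close>

lemma subdifferential_domain:
  assumes "h \<in> subdifferential M E u" "u \<in> L2 M"
  shows "u \<in> l2_domain M E"
proof -
  obtain g where g: "g \<in> L2 M" "E g \<noteq> \<infinity>" using proper by (auto simp: l2_proper_def)
  then have "enn2ereal (E u) + ereal (l2_inner M h (\<lambda>x. g x - u x)) \<le> enn2ereal (E g)"
    using assms by (auto simp: subdifferential_def)
  then show ?thesis using g assms(2)
    by (cases "E u"; cases "E g") (auto simp: l2_domain_def)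
qed

lemma subdifferential_le:
  assumes "h \<in> subdifferential M E u" "u \<in> L2 M" "g \<in> l2_domain M E"
  shows "enn2real (E u) + l2_inner M h (\<lambda>x. g x - u x) \<le> enn2real (E g)"
proof -
  have "enn2ereal (E u) + ereal (l2_inner M h (\<lambda>x. g x - u x)) \<le> enn2ereal (E g)"
    using assms by (auto simp: subdifferential_def l2_domain_def)
  then show ?thesis
    using subdifferential_domain[OF assms(1,2)] assms(3)
    by (cases "E u"; cases "E g") (auto simp: l2_domain_def)
qed

text \<open>Since the domain is convex, the segment from \<open>p\<close> to \<open>f\<close> lies
  in its closure. Minimality of \<open>p\<close> along this segment, to first order at
  \<open>p\<close>, shows that \<open>z - p\<close> and \<open>f - p\<close> have nonpositive inner
  product \<open>a\<close>; expanding the square gives the claim.\<close>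

lemma nearest_point_pythagoras:
  assumes p: "l2_nearest_point M (l2_closure M (l2_domain M E)) z p"
    and z: "z \<in> L2 M" and f: "f \<in> l2_domain M E"
  shows "(l2_norm M (\<lambda>x. z x - p x))\<^sup>2 + (l2_norm M (\<lambda>x. p x - f x))\<^sup>2
    \<le> (l2_norm M (\<lambda>x. z x - f x))\<^sup>2"
proof -
  have pL: "p \<in> L2 M" and fL: "f \<in> L2 M"
    using p f l2_closure_subset by (auto simp: l2_nearest_point_def l2_domain_def)
  define a where "a = l2_inner M (\<lambda>x. z x - p x) (\<lambda>x. f x - p x)"
  define b where "b = (l2_norm M (\<lambda>x. f x - p x))\<^sup>2"
  have zpL: "(\<lambda>x. z x - p x) \<in> L2 M" and fpL: "(\<lambda>x. f x - p x) \<in> L2 M"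
    using z pL fL by (auto intro: L2_diff)
  have *: "2 * a \<le> t * b" if t: "0 < t" "t \<le> 1" for t
  proof -
    let ?y = "\<lambda>x. (1 - t) * p x + t * f x"
    have "?y \<in> l2_closure M (l2_domain M E)"
      unfolding l2_closure_def
    proof (clarsimp, intro conjI allI impI)
      show "?y \<in> L2 M" using pL fL by (intro L2_intros)
      fix e :: real assume "e > 0"
      then obtain g where g: "g \<in> l2_domain M E" "l2_norm M (\<lambda>x. p x - g x) < e"
        using p by (auto simp: l2_nearest_point_def l2_closure_def)
      have "l2_norm M (\<lambda>x. ?y x - ((1 - t) * g x + t * f x))
          = l2_norm M (\<lambda>x. (1 - t) * (p x - g x))"
        by (simp add: algebra_simps)
      also have "\<dots> \<le> 1 * l2_norm M (\<lambda>x. p x - g x)"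
        using t unfolding l2_norm_cmult by (intro mult_right_mono) (auto simp: l2_norm_nonneg)
      finally have "l2_norm M (\<lambda>x. ?y x - ((1 - t) * g x + t * f x)) < e"
        using g(2) by simp
      moreover have "(\<lambda>x. (1 - t) * g x + t * f x) \<in> l2_domain M E"
        using domain_convex(1)[OF g(1) f] t by simp
      ultimately show "\<exists>g\<in>l2_domain M E. l2_norm M (\<lambda>x. ?y x - g x) < e" by (rule bexI)
    qed
    then have "l2_norm M (\<lambda>x. z x - p x) \<le> l2_norm M (\<lambda>x. z x - ?y x)"
      using p by (auto simp: l2_nearest_point_def)
    also have "(\<lambda>x. z x - ?y x) = (\<lambda>x. (z x - p x) - t * (f x - p x))"
      by (auto simp: algebra_simps)
    finally have "(l2_norm M (\<lambda>x. z x - p x))\<^sup>2 \<le> (l2_norm M (\<lambda>x. (z x - p x) - t * (f x - p x)))\<^sup>2"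
      by (intro power_mono) (auto simp: l2_norm_nonneg)
    also have "\<dots> = (l2_norm M (\<lambda>x. z x - p x))\<^sup>2 - 2 * (t * a) + t\<^sup>2 * b"
      using zpL fpL
      by (simp add: l2_norm_power2_diff L2_cmult l2_inner_cmult_right l2_norm_cmult
          power_mult_distrib a_def b_def)
    finally have "t * (2 * a) \<le> t * (t * b)" by (simp add: power2_eq_square algebra_simps)
    then show ?thesis using t by simp
  qed
  have "a \<le> 0"
  proof (rule tendsto_lowerbound)
    show "((\<lambda>t. t * b / 2) \<longlongrightarrow> 0) (at_right 0)" by (auto intro!: tendsto_eq_intros)
    show "\<forall>\<^sub>F t in at_right 0. a \<le> t * b / 2"
      unfolding eventually_at_right_field proof (intro exI[of _ 1] conjI allI impI)
      fix t :: real assume "0 < t" "t < 1"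
      then show "a \<le> t * b / 2" using *[of t] by simp
    qed simp
  qed auto
  have "(l2_norm M (\<lambda>x. z x - f x))\<^sup>2 = (l2_norm M (\<lambda>x. (z x - p x) - (f x - p x)))\<^sup>2"
    by simp
  also have "\<dots> = (l2_norm M (\<lambda>x. z x - p x))\<^sup>2 - 2 * a + b"
    using zpL fpL by (simp only: l2_norm_power2_diff a_def b_def)
  finally show ?thesis
    using \<open>a \<le> 0\<close> by (simp add: b_def l2_norm_minus_commute[of M f p])
qed

end

section \<open>Gradient flows\<close>

lemma gradient_flow_L2: "gradient_flow M E f u \<Longrightarrow> 0 \<le> t \<Longrightarrow> u t \<in> L2 M"
  by (simp add: gradient_flow_def)

lemma gradient_flow_tendsto:
  "gradient_flow M E f u \<Longrightarrow> 0 < t \<Longrightarrow> ((\<lambda>s. l2_norm M (\<lambda>x. u s x - u t x)) \<longlongrightarrow> 0) (at t)"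
  unfolding gradient_flow_def l2_tendsto_def by blast

lemma gradient_flow_derivative:
  assumes "gradient_flow M E f u" "0 < t"
  obtains v where "v \<in> L2 M"
    "((\<lambda>s. l2_norm M (\<lambda>x. (u s x - u t x) / (s - t) - v x)) \<longlongrightarrow> 0) (at_right t)"
    "(\<lambda>x. - v x) \<in> subdifferential M E (u t)"
  using assms unfolding gradient_flow_def has_l2_right_derivative_def l2_tendsto_def by blast

lemma gradient_flow_initial:
  assumes "gradient_flow M E f u"
  obtains p where "l2_nearest_point M (l2_closure M (l2_domain M E)) f p" "p \<in> L2 M"
    "((\<lambda>s. l2_norm M (\<lambda>x. u s x - p x)) \<longlongrightarrow> 0) (at_right 0)"
proof -
  obtain p where p: "l2_nearest_point M (l2_closure M (l2_domain M E)) f p"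
      "l2_tendsto M u p (at_right 0)"
    using assms unfolding gradient_flow_def by blast
  then have "p \<in> L2 M" using l2_closure_subset by (auto simp: l2_nearest_point_def)
  with p show thesis using that by (simp add: l2_tendsto_def)
qed

lemma gradient_flow_eventually_L2:
  assumes "gradient_flow M E f u" "0 < t"
  shows "eventually (\<lambda>s. u s \<in> L2 M) (at t)"
proof -
  have "eventually (\<lambda>s. 0 < s) (at t)"
    using assms(2) by (intro order_tendstoD(1)[OF tendsto_ident_at])
  then show ?thesis
    by eventually_elim (simp add: gradient_flow_L2[OF assms(1)])
qed

lemma gradient_flow_eventually_L2_0:
  assumes "gradient_flow M E f u"
  shows "eventually (\<lambda>s. u s \<in> L2 M) (at_right 0)"
  unfolding eventually_at_right_field
  by (rule exI[of _ 1]) (simp add: gradient_flow_L2[OF assms])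

text \<open>With \<open>D s\<close> a difference quotient at \<open>t\<close>, this disposes of the
  second-order remainders in the slope bounds.\<close>

lemma tendsto_mult_norm_power2_at_right:
  assumes "((\<lambda>s. l2_norm M (D s)) \<longlongrightarrow> c) (at_right t)"
  shows "((\<lambda>s. (s - t) * (l2_norm M (D s))\<^sup>2) \<longlongrightarrow> 0) (at_right t)"
proof -
  have "((\<lambda>s. s - t) \<longlongrightarrow> 0) (at_right t)"
    by (auto intro!: tendsto_eq_intros)
  from tendsto_mult[OF this tendsto_power[OF assms, of 2]] show ?thesis by simp
qed

lemma continuous_on_interval_of_tendsto:
  fixes h :: "real \<Rightarrow> real"
  assumes "\<And>t. 0 < t \<Longrightarrow> (h \<longlongrightarrow> h t) (at t)" "0 < a"
  shows "continuous_on {a..b} h"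
  by (rule continuous_at_imp_continuous_on) (use assms in \<open>auto simp: isCont_def\<close>)

subsection \<open>From the inequality to invariance\<close>

definition truncation_contractive ::
    "'a measure \<Rightarrow> (('a \<Rightarrow> real) \<Rightarrow> ennreal) \<Rightarrow> (real \<Rightarrow> real) \<Rightarrow> bool" where
  "truncation_contractive M E \<phi> \<longleftrightarrow> (\<forall>f\<in>L2 M. \<forall>g\<in>L2 M.
     E (\<lambda>x. f x - \<phi> (f x - g x)) + E (\<lambda>x. g x + \<phi> (f x - g x)) \<le> E f + E g)"

locale truncated_functional = convex_l2_functional M E + soft_truncation \<phi>
  for M :: "'a measure" and E :: "('a \<Rightarrow> real) \<Rightarrow> ennreal" and \<phi> :: "real \<Rightarrow> real"
begin

text \<open>A finite right-hand side in the contraction inequality forces both terms on the left to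
  be finite; afterwards one can compute with real values and subtract.\<close>

lemma contractive_domain:
  assumes "truncation_contractive M E \<phi>" "f \<in> l2_domain M E" "g \<in> l2_domain M E"
  shows "(\<lambda>x. f x - \<phi> (f x - g x)) \<in> l2_domain M E" (is "?f \<in> _")
    and "(\<lambda>x. g x + \<phi> (f x - g x)) \<in> l2_domain M E" (is "?g \<in> _")
    and "enn2real (E (\<lambda>x. f x - \<phi> (f x - g x))) + enn2real (E (\<lambda>x. g x + \<phi> (f x - g x)))
      \<le> enn2real (E f) + enn2real (E g)"
proof -
  have L: "?f \<in> L2 M" "?g \<in> L2 M"
    using assms(2,3) by (auto intro!: L2_intros L2_comp dest: domain_L2)
  have le: "E ?f + E ?g \<le> E f + E g"
    using assms by (auto simp: truncation_contractive_def l2_domain_def)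
  also have sum: "E f + E g = ennreal (enn2real (E f) + enn2real (E g))"
    using assms(2,3) by (simp add: ennreal_plus flip: E_eq_ennreal)
  finally have "E ?f + E ?g < \<infinity>" by (rule order.strict_trans1) simp
  then show f: "?f \<in> l2_domain M E" and g: "?g \<in> l2_domain M E"
    using L by (auto simp: l2_domain_def)
  have "E ?f + E ?g = ennreal (enn2real (E ?f) + enn2real (E ?g))"
    using f g by (simp add: ennreal_plus flip: E_eq_ennreal)
  with le sum show "enn2real (E ?f) + enn2real (E ?g) \<le> enn2real (E f) + enn2real (E g)"
    by (simp flip: ennreal_plus)
qed

text \<open>
  The flow starts from the nearest points of \<open>f\<close> and \<open>g\<close> in the closure of the domain. With
  \<open>w = \<phi>(p - q)\<close>, the pair \<open>(p - w/4, q + w/4)\<close> lies in that closure and would be strictly closer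
  to \<open>(f, g)\<close> if \<open>w\<close> were not null.
\<close>

lemma contractive_nearest_points:
  assumes C: "truncation_contractive M E \<phi>"
    and p: "l2_nearest_point M (l2_closure M (l2_domain M E)) f p" and f: "f \<in> L2 M"
    and q: "l2_nearest_point M (l2_closure M (l2_domain M E)) g q" and g: "g \<in> L2 M"
    and ae: "AE x in M. \<phi> (f x - g x) = 0"
  shows "l2_norm M (\<lambda>x. \<phi> (p x - q x)) = 0"
proof -
  let ?D = "l2_domain M E"
  let ?w = "\<lambda>x. \<phi> (p x - q x)"
  \<comment> \<open>With a step \<open>c\<close> in place of 1/4, minimality bounds the inner
    product of \<open>w\<close> with \<open>(f - g) - (p - q)\<close> below by \<open>- c\<close>
    times the squared norm of \<open>w\<close>, while the subgradient inequality bounds it above by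
    -1/2 times that. Any positive \<open>c\<close> strictly below 1/2 forces \<open>w\<close> to be
    null. The sign in \<open>?q\<close> is written so that \<open>norm_shift_diff_le\<close> applies
    to both.\<close>
  let ?p = "\<lambda>x. p x - 1/4 * ?w x" and ?q = "\<lambda>x. q x - (- 1/4) * ?w x"
  have pL: "p \<in> L2 M" and qL: "q \<in> L2 M"
    using p q l2_closure_subset by (auto simp: l2_nearest_point_def)
  have wL: "?w \<in> L2 M" using pL qL by (intro L2_comp L2_diff)
  have "\<exists>h\<in>?D. l2_norm M (\<lambda>x. ?p x - h x) < e" "\<exists>h\<in>?D. l2_norm M (\<lambda>x. ?q x - h x) < e"
    if "e > 0" for e
  proof -
    obtain p' where p': "p' \<in> ?D" "l2_norm M (\<lambda>x. p x - p' x) < e / 2"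
      using p \<open>e > 0\<close> half_gt_zero unfolding l2_nearest_point_def l2_closure_def by blast
    obtain q' where q': "q' \<in> ?D" "l2_norm M (\<lambda>x. q x - q' x) < e / 2"
      using q \<open>e > 0\<close> half_gt_zero unfolding l2_nearest_point_def l2_closure_def by blast
    note L' = domain_L2[OF p'(1)] domain_L2[OF q'(1)]
    let ?w' = "\<lambda>x. \<phi> (p' x - q' x)"
    \<comment> \<open>The hypothesis concerns the full shift by \<open>w'\<close>; convexity brings
      the quarter shift into the domain.\<close>
    have "(\<lambda>x. (1 - 1/4) * p' x + 1/4 * (p' x - ?w' x)) \<in> ?D"
      by (rule domain_convex(1)[OF p'(1) contractive_domain(1)[OF C p'(1) q'(1)]]) auto
    also have "(\<lambda>x. (1 - 1/4) * p' x + 1/4 * (p' x - ?w' x)) = (\<lambda>x. p' x - 1/4 * ?w' x)"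
      by (auto simp: algebra_simps)
    finally have pD: "(\<lambda>x. p' x - 1/4 * ?w' x) \<in> ?D" .
    have "(\<lambda>x. (1 - 1/4) * q' x + 1/4 * (q' x + ?w' x)) \<in> ?D"
      by (rule domain_convex(1)[OF q'(1) contractive_domain(2)[OF C p'(1) q'(1)]]) auto
    also have "(\<lambda>x. (1 - 1/4) * q' x + 1/4 * (q' x + ?w' x)) = (\<lambda>x. q' x - (- 1/4) * ?w' x)"
      by (auto simp: algebra_simps)
    finally have qD: "(\<lambda>x. q' x - (- 1/4) * ?w' x) \<in> ?D" .
    \<comment> \<open>The error is below \<open>e/2 + (1/4) * e\<close>, that is, three quarters of
      \<open>e\<close>.\<close>
    have small: "X + \<bar>c\<bar> * (X + Y) < e" "Y + \<bar>c\<bar> * (X + Y) < e"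
      if "\<bar>c\<bar> = 1/4" "X < e / 2" "Y < e / 2" for X Y c :: real
      using that(2,3) \<open>e > 0\<close> unfolding that(1) by (simp_all add: field_simps)
    note shift = norm_shift_diff_le[OF _ _ pL L'(1) qL L'(2)]
    have pe: "l2_norm M (\<lambda>x. ?p x - (p' x - 1/4 * ?w' x)) < e"
      by (rule order.strict_trans1[OF shift[OF pL L'(1)]]) (rule small; use p'(2) q'(2) in simp)
    have qe: "l2_norm M (\<lambda>x. ?q x - (q' x - (- 1/4) * ?w' x)) < e"
      by (rule order.strict_trans1[OF shift[OF qL L'(2)]]) (rule small; use p'(2) q'(2) in simp)
    show "\<exists>h\<in>?D. l2_norm M (\<lambda>x. ?p x - h x) < e" "\<exists>h\<in>?D. l2_norm M (\<lambda>x. ?q x - h x) < e"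
      by (rule bexI[OF _ pD], rule pe, rule bexI[OF _ qD], rule qe)
  qed
  moreover have "?p \<in> L2 M" "?q \<in> L2 M"
    by (intro L2_diff L2_cmult pL wL, intro L2_diff L2_cmult qL wL)
  ultimately have "?p \<in> l2_closure M ?D" "?q \<in> l2_closure M ?D"
    unfolding l2_closure_def by blast+
  then have "l2_norm M (\<lambda>x. f x - p x) \<le> l2_norm M (\<lambda>x. f x - ?p x)"
    "l2_norm M (\<lambda>x. g x - q x) \<le> l2_norm M (\<lambda>x. g x - ?q x)"
    using p q by (auto simp: l2_nearest_point_def)
  then have "(l2_norm M (\<lambda>x. f x - p x))\<^sup>2 \<le> (l2_norm M (\<lambda>x. f x - ?p x))\<^sup>2"
    "(l2_norm M (\<lambda>x. g x - q x))\<^sup>2 \<le> (l2_norm M (\<lambda>x. g x - ?q x))\<^sup>2"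
    by (auto intro!: power_mono l2_norm_nonneg)
  moreover have "(\<lambda>x. f x - ?p x) = (\<lambda>x. (f x - p x) + 1/4 * ?w x)"
    "(\<lambda>x. g x - ?q x) = (\<lambda>x. (g x - q x) + (- 1/4) * ?w x)" by auto
  moreover note l2_norm_power2_add_cmult[OF L2_diff[OF f pL] wL, of "1/4"]
    l2_norm_power2_add_cmult[OF L2_diff[OF g qL] wL, of "- 1/4"]
  ultimately have "0 \<le> 1/2 * l2_inner M (\<lambda>x. f x - p x) ?w + 1/16 * (l2_norm M ?w)\<^sup>2"
    "0 \<le> - (1/2 * l2_inner M (\<lambda>x. g x - q x) ?w) + 1/16 * (l2_norm M ?w)\<^sup>2"
    by (simp_all add: power_divide)
  then have *: "0 \<le> l2_inner M (\<lambda>x. f x - p x) ?w - l2_inner M (\<lambda>x. g x - q x) ?w + (l2_norm M ?w)\<^sup>2 / 4"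
    by simp
  have "l2_norm M (\<lambda>x. \<phi> (f x - g x)) = 0"
    using f g ae by (subst l2_norm_eq_0_iff) (auto intro: L2_comp L2_diff)
  then have "(l2_norm M ?w)\<^sup>2 / 2 + l2_inner M ?w (\<lambda>x. (f x - g x) - (p x - q x)) \<le> 0"
    using norm_comp_power2_le[of "\<lambda>x. f x - g x" M "\<lambda>x. p x - q x"] f g pL qL by (simp add: L2_diff)
  moreover have "l2_inner M ?w (\<lambda>x. (f x - g x) - (p x - q x))
      = l2_inner M (\<lambda>x. f x - p x) ?w - l2_inner M (\<lambda>x. g x - q x) ?w"
    using f g pL qL wL by (simp add: l2_inner_commute[of _ _ ?w] l2_inner_diff_right L2_diff)
  ultimately have "(l2_norm M ?w)\<^sup>2 \<le> 0" using * by linarith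
  then show ?thesis by simp
qed

text \<open>For positive times, half the squared norm of \<open>\<phi> (u - v)\<close> has right
  slope at most the inner product of \<open>\<phi> (u - v)\<close> with \<open>u' - v'\<close>,
  which the two subgradient inequalities make nonpositive. Its limit at time 0 vanishes by
  \<open>contractive_nearest_points\<close>.\<close>

lemma contractive_imp_flow_invariant:
  assumes C: "truncation_contractive M E \<phi>"
    and f: "f \<in> L2 M" and g: "g \<in> L2 M"
    and u: "gradient_flow M E f u" and v: "gradient_flow M E g v"
    and ae: "AE x in M. \<phi> (f x - g x) = 0" and "0 \<le> t"
  shows "AE x in M. \<phi> (u t x - v t x) = 0"
proof (cases "t = 0")
  case True
  \<comment> \<open>At time 0 the flow is \<open>f\<close> itself, which may differ from its right
    limit, the nearest point \<open>p\<close>.\<close>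
  have "AE x in M. u 0 x = f x" "AE x in M. v 0 x = g x"
    using u v by (auto simp: gradient_flow_def)
  with ae show ?thesis unfolding True by eventually_elim simp
next
  case False
  with \<open>0 \<le> t\<close> have "0 < t" by simp
  define h where "h s = (l2_norm M (\<lambda>x. \<phi> (u s x - v s x)))\<^sup>2 / 2" for s
  have uL: "u s \<in> L2 M" and vL: "v s \<in> L2 M" if "0 \<le> s" for s
    using u v that by (auto intro: gradient_flow_L2)
  have cont: "(h \<longlongrightarrow> h s) (at s)" if "0 < s" for s
  proof -
    note ev = gradient_flow_eventually_L2[OF u that] gradient_flow_eventually_L2[OF v that]
    have "((\<lambda>r. l2_norm M (\<lambda>x. (u r x - v r x) - (u s x - v s x))) \<longlongrightarrow> 0) (at s)"
      using that by (intro tendsto_l2_diff_diff[OF ev] uL vL gradient_flow_tendsto[OF u]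
          gradient_flow_tendsto[OF v]) auto
    moreover from ev have "eventually (\<lambda>r. (\<lambda>x. u r x - v r x) \<in> L2 M) (at s)"
      by eventually_elim (rule L2_diff)
    ultimately show ?thesis
      unfolding h_def using uL vL that
      by (intro tendsto_divide tendsto_power tendsto_norm_comp tendsto_const) (auto intro: L2_diff)
  qed
  have mono: "h b \<le> h a" if "0 < a" "a \<le> b" for a b
  proof (rule real_le_of_right_slope_nonpos[OF that(2)])
    show "continuous_on {a..b} h" by (rule continuous_on_interval_of_tendsto[OF cont that(1)])
    fix s assume "a \<le> s" "s < b"
    with that have "0 < s" by simp
    obtain u' where u': "u' \<in> L2 M"
        "((\<lambda>r. l2_norm M (\<lambda>x. (u r x - u s x) / (r - s) - u' x)) \<longlongrightarrow> 0) (at_right s)"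
        "(\<lambda>x. - u' x) \<in> subdifferential M E (u s)"
      by (rule gradient_flow_derivative[OF u \<open>0 < s\<close>])
    obtain v' where v': "v' \<in> L2 M"
        "((\<lambda>r. l2_norm M (\<lambda>x. (v r x - v s x) / (r - s) - v' x)) \<longlongrightarrow> 0) (at_right s)"
        "(\<lambda>x. - v' x) \<in> subdifferential M E (v s)"
      by (rule gradient_flow_derivative[OF v \<open>0 < s\<close>])
    let ?w = "\<lambda>r x. u r x - v r x"
    let ?\<phi> = "\<lambda>x. \<phi> (?w s x)"
    let ?Du = "\<lambda>r x. (u r x - u s x) / (r - s)" and ?Dv = "\<lambda>r x. (v r x - v s x) / (r - s)"
    let ?D = "\<lambda>r x. ?Du r x - ?Dv r x"
    note us = uL[OF less_imp_le[OF \<open>0 < s\<close>]] and vs = vL[OF less_imp_le[OF \<open>0 < s\<close>]]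
    have \<phi>L: "?\<phi> \<in> L2 M" by (intro L2_comp L2_diff us vs)
    have evr: "eventually (\<lambda>r. s < r) (at_right s)" by (rule eventually_at_right_less)
    have evDu: "\<forall>\<^sub>F r in at_right s. ?Du r \<in> L2 M"
      using evr by eventually_elim (use \<open>0 < s\<close> in \<open>intro L2_divide L2_diff uL us; simp\<close>)
    have evDv: "\<forall>\<^sub>F r in at_right s. ?Dv r \<in> L2 M"
      using evr by eventually_elim (use \<open>0 < s\<close> in \<open>intro L2_divide L2_diff vL vs; simp\<close>)
    from evDu evDv have evD': "\<forall>\<^sub>F r in at_right s. ?D r \<in> L2 M"
      by eventually_elim (rule L2_diff)
    have limD: "((\<lambda>r. l2_norm M (\<lambda>x. ?D r x - (u' x - v' x))) \<longlongrightarrow> 0) (at_right s)"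
      by (rule tendsto_l2_diff_diff[OF evDu evDv u'(1) v'(1) u'(2) v'(2)])
    \<comment> \<open>The second summand pays for evaluating \<open>\<phi>\<close> at time
      \<open>s\<close> although the subgradient inequality produces it at time
      \<open>r\<close>.\<close>
    let ?q = "\<lambda>r. l2_inner M ?\<phi> (?D r) + (r - s) * (l2_norm M (?D r))\<^sup>2"
    have duL: "(\<lambda>x. u' x - v' x) \<in> L2 M" by (intro L2_diff u' v')
    have limN: "((\<lambda>r. l2_norm M (?D r)) \<longlongrightarrow> l2_norm M (\<lambda>x. u' x - v' x)) (at_right s)"
      by (rule tendsto_l2_norm[OF evD' duL limD])
    have "(?q \<longlongrightarrow> l2_inner M ?\<phi> (\<lambda>x. u' x - v' x) + 0) (at_right s)"
      by (rule tendsto_add[OF tendsto_l2_inner[OF evD' duL \<phi>L limD]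
          tendsto_mult_norm_power2_at_right[OF limN]])
    moreover have "l2_inner M ?\<phi> (\<lambda>x. u' x - v' x) + 0 \<le> 0"
    proof -
      \<comment> \<open>The subgradient inequalities of \<open>u s\<close> and \<open>v s\<close>,
        tested with the truncated functions, are added; the contraction inequality cancels all
        values of \<open>E\<close>.\<close>
      note D = subdifferential_domain[OF u'(3) us] subdifferential_domain[OF v'(3) vs]
      note cd = contractive_domain[OF C D]
      have "enn2real (E (u s)) + l2_inner M (\<lambda>x. - u' x) (\<lambda>x. (u s x - ?\<phi> x) - u s x)
          \<le> enn2real (E (\<lambda>x. u s x - ?\<phi> x))"
        by (rule subdifferential_le[OF u'(3) us cd(1)])
      moreover have "enn2real (E (v s)) + l2_inner M (\<lambda>x. - v' x) (\<lambda>x. (v s x + ?\<phi> x) - v s x)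
          \<le> enn2real (E (\<lambda>x. v s x + ?\<phi> x))"
        by (rule subdifferential_le[OF v'(3) vs cd(2)])
      ultimately have "l2_inner M u' ?\<phi> - l2_inner M v' ?\<phi> \<le> 0"
        using cd(3) by (simp add: l2_inner_uminus_left l2_inner_uminus_right)
      then show ?thesis
        using u'(1) v'(1) \<phi>L by (simp add: l2_inner_diff_left l2_inner_commute[of _ ?\<phi>])
    qed
    moreover have "\<forall>\<^sub>F r in at_right s. h r - h s \<le> (r - s) * ?q r"
      using evr evD'
    proof eventually_elim
      case (elim r)
      have "u r \<in> L2 M" "v r \<in> L2 M" using uL vL elim \<open>0 < s\<close> by auto
      then have wL: "?w r \<in> L2 M" "?w s \<in> L2 M" using us vs by (auto intro: L2_diff)
      let ?d = "\<lambda>x. ?w r x - ?w s x"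
      have dL: "?d \<in> L2 M" using wL by (rule L2_diff)
      have d: "?d = (\<lambda>x. (r - s) * ?D r x)" using elim unfolding diff_divide_distrib[symmetric]
        by (simp, simp add: algebra_simps)
      \<comment> \<open>The subgradient is taken at the later time \<open>r\<close>, since this is
        the choice that bounds \<open>h r - h s\<close> from above. Passing to time \<open>s\<close>
        costs at most the squared norm of \<open>?d\<close>, by the Lipschitz property.\<close>
      have "h r + l2_inner M (\<lambda>x. \<phi> (?w r x)) (\<lambda>x. ?w s x - ?w r x) \<le> h s"
        using norm_comp_power2_le[OF wL(2) wL(1)] by (simp add: h_def)
      moreover have "l2_inner M (\<lambda>x. \<phi> (?w r x)) (\<lambda>x. ?w s x - ?w r x)
          = - l2_inner M (\<lambda>x. \<phi> (?w r x)) ?d"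
        by (simp flip: l2_inner_uminus_right)
      moreover have "l2_inner M (\<lambda>x. \<phi> (?w r x)) ?d
          = l2_inner M ?\<phi> ?d + l2_inner M (\<lambda>x. \<phi> (?w r x) - ?\<phi> x) ?d"
        using l2_inner_diff_left[OF L2_comp[OF wL(1)] L2_comp[OF wL(2)] dL] by simp
      moreover have "l2_inner M (\<lambda>x. \<phi> (?w r x) - ?\<phi> x) ?d \<le> l2_norm M ?d * l2_norm M ?d"
      proof -
        have "l2_inner M (\<lambda>x. \<phi> (?w r x) - ?\<phi> x) ?d
            \<le> l2_norm M (\<lambda>x. \<phi> (?w r x) - ?\<phi> x) * l2_norm M ?d"
          by (rule order_trans[OF abs_ge_self l2_Cauchy_Schwarz])
            (use wL dL in \<open>auto intro: L2_comp L2_diff\<close>)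
        also have "\<dots> \<le> l2_norm M ?d * l2_norm M ?d"
          by (rule mult_right_mono[OF norm_comp_diff_le[OF wL] l2_norm_nonneg])
        finally show ?thesis .
      qed
      ultimately have "h r - h s \<le> l2_inner M ?\<phi> ?d + (l2_norm M ?d)\<^sup>2"
        by (simp add: power2_eq_square)
      also have "\<dots> = (r - s) * ?q r"
        unfolding d l2_inner_cmult_right l2_norm_cmult
        by (simp add: power_mult_distrib) (simp add: power2_eq_square algebra_simps)
      finally show ?case .
    qed
    ultimately show "\<exists>q l. (q \<longlongrightarrow> l) (at_right s) \<and> l \<le> 0 \<and>
        (\<forall>\<^sub>F r in at_right s. h r - h s \<le> (r - s) * q r)"
      by blast
  qed
  obtain p where p: "l2_nearest_point M (l2_closure M (l2_domain M E)) f p" and pL: "p \<in> L2 M"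
      and limp: "((\<lambda>r. l2_norm M (\<lambda>x. u r x - p x)) \<longlongrightarrow> 0) (at_right 0)"
    by (rule gradient_flow_initial[OF u])
  obtain q where q: "l2_nearest_point M (l2_closure M (l2_domain M E)) g q" and qL: "q \<in> L2 M"
      and limq: "((\<lambda>r. l2_norm M (\<lambda>x. v r x - q x)) \<longlongrightarrow> 0) (at_right 0)"
    by (rule gradient_flow_initial[OF v])
  note ev = gradient_flow_eventually_L2_0[OF u] gradient_flow_eventually_L2_0[OF v]
  have "((\<lambda>r. l2_norm M (\<lambda>x. (u r x - v r x) - (p x - q x))) \<longlongrightarrow> 0) (at_right 0)"
    by (rule tendsto_l2_diff_diff[OF ev pL qL limp limq])
  moreover from ev have "eventually (\<lambda>r. (\<lambda>x. u r x - v r x) \<in> L2 M) (at_right 0)"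
    by eventually_elim (rule L2_diff)
  ultimately have "(h \<longlongrightarrow> (l2_norm M (\<lambda>x. \<phi> (p x - q x)))\<^sup>2 / 2) (at_right 0)"
    unfolding h_def using pL qL
    by (intro tendsto_divide tendsto_power tendsto_norm_comp tendsto_const) (auto intro: L2_diff)
  then have lim: "(h \<longlongrightarrow> 0) (at_right 0)"
    using contractive_nearest_points[OF C p f q g ae] by simp
  have "h t \<le> 0"
  proof (rule tendsto_lowerbound[OF lim])
    show "\<forall>\<^sub>F s in at_right 0. h t \<le> h s"
      unfolding eventually_at_right_field using \<open>0 < t\<close> mono by (intro exI[of _ t]) auto
  qed simp
  then have "l2_norm M (\<lambda>x. \<phi> (u t x - v t x)) = 0" by (simp add: h_def)
  moreover have "(\<lambda>x. \<phi> (u t x - v t x)) \<in> L2 M"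
    using \<open>0 \<le> t\<close> by (intro L2_comp L2_diff uL vL)
  ultimately show ?thesis by (simp add: l2_norm_eq_0_iff)
qed

end

subsection \<open>From invariance to the inequality\<close>

context truncated_functional
begin

text \<open>With \<open>w = \<phi> (f - g)\<close>, no pair satisfying the constraint is closer to
  \<open>(f, g)\<close> than \<open>(f - w/2, g + w/2)\<close>, whose squared distance is half the
  squared norm of \<open>w\<close>. The bound compares \<open>\<phi> (f - g)\<close> with
  \<open>\<phi> (a - b) = 0\<close> by the Lipschitz property.\<close>

lemma norm_power2_le_of_comp_eq_0:
  assumes "f \<in> L2 M" "g \<in> L2 M" "a \<in> L2 M" "b \<in> L2 M" "AE x in M. \<phi> (a x - b x) = 0"
  shows "(l2_norm M (\<lambda>x. \<phi> (f x - g x)))\<^sup>2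
    \<le> 2 * ((l2_norm M (\<lambda>x. a x - f x))\<^sup>2 + (l2_norm M (\<lambda>x. b x - g x))\<^sup>2)"
proof -
  let ?A = "l2_norm M (\<lambda>x. a x - f x)" and ?B = "l2_norm M (\<lambda>x. b x - g x)"
  have "l2_norm M (\<lambda>x. \<phi> (f x - g x)) \<le> l2_norm M (\<lambda>x. (a x - b x) - (f x - g x))"
  proof (rule l2_norm_mono)
    show "AE x in M. \<bar>\<phi> (f x - g x)\<bar> \<le> \<bar>(a x - b x) - (f x - g x)\<bar>"
      using assms(5)
    proof eventually_elim
      case (elim x)
      then show ?case using lipschitz[of "a x - b x" "f x - g x"] by simp
    qed
  qed (intro L2_measurable L2_comp L2_diff assms)+
  also have "\<dots> \<le> ?A + ?B" by (rule l2_norm_diff_diff_le) fact+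
  finally have "(l2_norm M (\<lambda>x. \<phi> (f x - g x)))\<^sup>2 \<le> (?A + ?B)\<^sup>2"
    by (rule power_mono) (rule l2_norm_nonneg)
  also have "\<dots> \<le> 2 * (?A\<^sup>2 + ?B\<^sup>2)"
    using sum_squares_bound[of ?A ?B] by (simp add: power2_sum)
  finally show ?thesis .
qed

text \<open>If the inequality failed, the subgradient inequalities tested with \<open>f\<close> and
  \<open>g\<close> would make the flow approach \<open>(f, g)\<close> at a positive rate, although
  it starts at the least distance that the constraint permits.\<close>

lemma flow_invariant_imp_half_contractive:
  assumes f: "f \<in> l2_domain M E" and g: "g \<in> l2_domain M E"
    and u: "gradient_flow M E (\<lambda>x. f x - 1/2 * \<phi> (f x - g x)) u" (is "gradient_flow M E ?y u")
    and v: "gradient_flow M E (\<lambda>x. g x + 1/2 * \<phi> (f x - g x)) v" (is "gradient_flow M E ?z v")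
    and inv: "\<And>t. 0 < t \<Longrightarrow> AE x in M. \<phi> (u t x - v t x) = 0"
  shows "E (\<lambda>x. f x - 1/2 * \<phi> (f x - g x)) + E (\<lambda>x. g x + 1/2 * \<phi> (f x - g x)) \<le> E f + E g"
proof (rule ccontr)
  let ?w = "\<lambda>x. \<phi> (f x - g x)"
  have fL: "f \<in> L2 M" and gL: "g \<in> L2 M" using f g by (auto dest: domain_L2)
  have wL: "?w \<in> L2 M" by (intro L2_comp L2_diff fL gL)
  have yL: "?y \<in> L2 M" and zL: "?z \<in> L2 M" by (intro L2_intros fL gL wL)+
  have uL: "u s \<in> L2 M" and vL: "v s \<in> L2 M" if "0 \<le> s" for s
    using u v that by (auto intro: gradient_flow_L2)
  note ev0 = gradient_flow_eventually_L2_0[OF u] gradient_flow_eventually_L2_0[OF v]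
  obtain p where p: "l2_nearest_point M (l2_closure M (l2_domain M E)) ?y p" and pL: "p \<in> L2 M"
      and limp: "((\<lambda>r. l2_norm M (\<lambda>x. u r x - p x)) \<longlongrightarrow> 0) (at_right 0)"
    by (rule gradient_flow_initial[OF u])
  obtain q where q: "l2_nearest_point M (l2_closure M (l2_domain M E)) ?z q" and qL: "q \<in> L2 M"
      and limq: "((\<lambda>r. l2_norm M (\<lambda>x. v r x - q x)) \<longlongrightarrow> 0) (at_right 0)"
    by (rule gradient_flow_initial[OF v])
  \<comment> \<open>The right limits at time 0 inherit the constraint, so \<open>(p, q)\<close> is
    no closer to \<open>(f, g)\<close> than \<open>(?y, ?z)\<close>. The Pythagorean inequality
    gives the reverse and leaves no room for a distance between the two pairs; hence the flows
    really start at \<open>?y\<close> and \<open>?z\<close>.\<close>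
  have "l2_norm M (\<lambda>x. \<phi> (p x - q x)) = 0"
  proof (rule tendsto_unique[of "at_right (0::real)"])
    from ev0 have "eventually (\<lambda>r. (\<lambda>x. u r x - v r x) \<in> L2 M) (at_right 0)"
      by eventually_elim (rule L2_diff)
    then show "((\<lambda>r. l2_norm M (\<lambda>x. \<phi> (u r x - v r x))) \<longlongrightarrow> l2_norm M (\<lambda>x. \<phi> (p x - q x))) (at_right 0)"
      by (rule tendsto_norm_comp[OF _ L2_diff[OF pL qL]
            tendsto_l2_diff_diff[OF ev0 pL qL limp limq]])
    have "\<forall>\<^sub>F r in at_right 0. l2_norm M (\<lambda>x. \<phi> (u r x - v r x)) = 0"
      using eventually_at_right_less[of "0::real"]
    proof eventually_elim
      case (elim r)
      then have "(\<lambda>x. \<phi> (u r x - v r x)) \<in> L2 M"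
        by (intro L2_comp L2_diff uL vL) auto
      with inv[OF elim] show ?case by (simp add: l2_norm_eq_0_iff)
    qed
    then show "((\<lambda>r. l2_norm M (\<lambda>x. \<phi> (u r x - v r x))) \<longlongrightarrow> 0) (at_right 0)"
      by (rule tendsto_eventually)
  qed simp
  then have "AE x in M. \<phi> (p x - q x) = 0"
    using l2_norm_eq_0_iff[OF L2_comp[OF L2_diff[OF pL qL]]] by simp
  note pq = norm_power2_le_of_comp_eq_0[OF fL gL pL qL this]
  have "(\<lambda>x. ?y x - f x) = (\<lambda>x. (- 1/2) * ?w x)" "(\<lambda>x. ?z x - g x) = (\<lambda>x. 1/2 * ?w x)"
    by auto
  then have yf: "(l2_norm M (\<lambda>x. ?y x - f x))\<^sup>2 = (l2_norm M ?w)\<^sup>2 / 4"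
    and zg: "(l2_norm M (\<lambda>x. ?z x - g x))\<^sup>2 = (l2_norm M ?w)\<^sup>2 / 4"
    by (simp_all only: l2_norm_cmult) (simp_all add: power_divide)
  have "(l2_norm M (\<lambda>x. ?y x - p x))\<^sup>2 + (l2_norm M (\<lambda>x. ?z x - q x))\<^sup>2 \<le> 0"
    using pq nearest_point_pythagoras[OF p yL f] nearest_point_pythagoras[OF q zL g]
    unfolding yf zg by argo
  then have "l2_norm M (\<lambda>x. ?y x - p x) = 0" "l2_norm M (\<lambda>x. ?z x - q x) = 0"
    by (simp_all add: sum_power2_le_zero_iff)
  then have y0: "l2_norm M (\<lambda>x. p x - ?y x) = 0" and z0: "l2_norm M (\<lambda>x. q x - ?z x) = 0"
    by (simp_all only: l2_norm_minus_commute[of M p] l2_norm_minus_commute[of M q])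
  have limy: "((\<lambda>r. l2_norm M (\<lambda>x. u r x - ?y x)) \<longlongrightarrow> 0) (at_right 0)"
    using tendsto_l2_norm_diff[OF ev0(1) pL yL limp] unfolding y0 .
  have limz: "((\<lambda>r. l2_norm M (\<lambda>x. v r x - ?z x)) \<longlongrightarrow> 0) (at_right 0)"
    using tendsto_l2_norm_diff[OF ev0(2) qL zL limq] unfolding z0 .

  assume "\<not> E ?y + E ?z \<le> E f + E g"
  then obtain c where c: "E f + E g < c" "c < E ?y + E ?z"
    using dense[of "E f + E g"] by (auto simp: not_le)
  have "\<forall>\<^sub>F s in at_right 0. c < E (u s) + E (v s)"
    by (rule l2_lsc_eventually_add[where E = E and y = ?y and z = ?z and u = u and v = v,
          OF lsc yL zL ev0 limy limz c(2)])
  then obtain \<tau> where "0 < \<tau>" and \<tau>: "\<And>s. 0 < s \<Longrightarrow> s < \<tau> \<Longrightarrow> c < E (u s) + E (v s)"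
    by (auto simp: eventually_at_right_field)
  have "c < top" using c(2) by (rule order_less_le_trans) simp
  define \<kappa> where "\<kappa> = enn2real c - (enn2real (E f) + enn2real (E g))"
  have "ennreal (enn2real (E f) + enn2real (E g)) = E f + E g"
    using f g by (simp add: ennreal_plus flip: E_eq_ennreal)
  also have "\<dots> < ennreal (enn2real c)"
    using c(1) \<open>c < top\<close> by simp
  finally have "0 < \<kappa>"
    unfolding \<kappa>_def by (simp add: ennreal_less_iff del: ennreal_plus)
  \<comment> \<open>That \<open>h\<close> is nonincreasing means that half the squared distance to
    \<open>(f, g)\<close> decreases at rate at least \<open>\<kappa>\<close>, the gap between
    \<open>c\<close> and \<open>E f + E g\<close>.\<close>
  define h where "h s = ((l2_norm M (\<lambda>x. u s x - f x))\<^sup>2 + (l2_norm M (\<lambda>x. v s x - g x))\<^sup>2) / 2 + \<kappa> * s" for s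
  have cont: "(h \<longlongrightarrow> h s) (at s)" if "0 < s" for s
    unfolding h_def using that
    by (intro tendsto_intros tendsto_l2_norm_diff[OF _ _ fL] tendsto_l2_norm_diff[OF _ _ gL]
        gradient_flow_eventually_L2[OF u] gradient_flow_eventually_L2[OF v]
        gradient_flow_tendsto[OF u] gradient_flow_tendsto[OF v] uL vL) auto
  have mono: "h b \<le> h a" if "0 < a" "a \<le> b" "b < \<tau>" for a b
  proof (rule real_le_of_right_slope_nonpos[OF that(2)])
    show "continuous_on {a..b} h" by (rule continuous_on_interval_of_tendsto[OF cont that(1)])
    fix s assume "a \<le> s" "s < b"
    with that have "0 < s" "s < \<tau>" by auto
    obtain u' where u': "u' \<in> L2 M"
        "((\<lambda>r. l2_norm M (\<lambda>x. (u r x - u s x) / (r - s) - u' x)) \<longlongrightarrow> 0) (at_right s)"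
        "(\<lambda>x. - u' x) \<in> subdifferential M E (u s)"
      by (rule gradient_flow_derivative[OF u \<open>0 < s\<close>])
    obtain v' where v': "v' \<in> L2 M"
        "((\<lambda>r. l2_norm M (\<lambda>x. (v r x - v s x) / (r - s) - v' x)) \<longlongrightarrow> 0) (at_right s)"
        "(\<lambda>x. - v' x) \<in> subdifferential M E (v s)"
      by (rule gradient_flow_derivative[OF v \<open>0 < s\<close>])
    let ?Du = "\<lambda>r x. (u r x - u s x) / (r - s)" and ?Dv = "\<lambda>r x. (v r x - v s x) / (r - s)"
    let ?uf = "\<lambda>x. u s x - f x" and ?vg = "\<lambda>x. v s x - g x"
    note us = uL[OF less_imp_le[OF \<open>0 < s\<close>]] and vs = vL[OF less_imp_le[OF \<open>0 < s\<close>]]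
    have ufL: "?uf \<in> L2 M" and vgL: "?vg \<in> L2 M" by (intro L2_diff us vs fL gL)+
    have evr: "eventually (\<lambda>r. s < r) (at_right s)" by (rule eventually_at_right_less)
    have evDu: "\<forall>\<^sub>F r in at_right s. ?Du r \<in> L2 M"
      using evr by eventually_elim (use \<open>0 < s\<close> in \<open>intro L2_divide L2_diff uL us; simp\<close>)
    have evDv: "\<forall>\<^sub>F r in at_right s. ?Dv r \<in> L2 M"
      using evr by eventually_elim (use \<open>0 < s\<close> in \<open>intro L2_divide L2_diff vL vs; simp\<close>)
    let ?qu = "\<lambda>r. l2_inner M ?uf (?Du r) + (r - s) * (l2_norm M (?Du r))\<^sup>2 / 2"
    let ?qv = "\<lambda>r. l2_inner M ?vg (?Dv r) + (r - s) * (l2_norm M (?Dv r))\<^sup>2 / 2"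
    have qu: "(?qu \<longlongrightarrow> l2_inner M ?uf u' + 0 / 2) (at_right s)"
      by (intro tendsto_add tendsto_divide tendsto_const
          tendsto_l2_inner[OF evDu u'(1) ufL u'(2)]
          tendsto_mult_norm_power2_at_right[OF tendsto_l2_norm[OF evDu u'(1) u'(2)]]) simp
    have qv: "(?qv \<longlongrightarrow> l2_inner M ?vg v' + 0 / 2) (at_right s)"
      by (intro tendsto_add tendsto_divide tendsto_const
          tendsto_l2_inner[OF evDv v'(1) vgL v'(2)]
          tendsto_mult_norm_power2_at_right[OF tendsto_l2_norm[OF evDv v'(1) v'(2)]]) simp
    have "((\<lambda>r. ?qu r + ?qv r + \<kappa>) \<longlongrightarrow>
        (l2_inner M ?uf u' + 0 / 2) + (l2_inner M ?vg v' + 0 / 2) + \<kappa>) (at_right s)"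
      by (rule tendsto_add[OF tendsto_add[OF qu qv] tendsto_const])
    moreover have "(l2_inner M ?uf u' + 0 / 2) + (l2_inner M ?vg v' + 0 / 2) + \<kappa> \<le> 0"
    proof -
      have "enn2real (E (u s)) + l2_inner M (\<lambda>x. - u' x) (\<lambda>x. f x - u s x) \<le> enn2real (E f)"
        by (rule subdifferential_le[OF u'(3) us f])
      moreover have "l2_inner M (\<lambda>x. - u' x) (\<lambda>x. f x - u s x) = l2_inner M ?uf u'"
        by (simp add: l2_inner_def algebra_simps)
      moreover have "enn2real (E (v s)) + l2_inner M (\<lambda>x. - v' x) (\<lambda>x. g x - v s x) \<le> enn2real (E g)"
        by (rule subdifferential_le[OF v'(3) vs g])
      moreover have "l2_inner M (\<lambda>x. - v' x) (\<lambda>x. g x - v s x) = l2_inner M ?vg v'"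
        by (simp add: l2_inner_def algebra_simps)
      moreover have "enn2real c \<le> enn2real (E (u s)) + enn2real (E (v s))"
      proof -
        note D = subdifferential_domain[OF u'(3) us] subdifferential_domain[OF v'(3) vs]
        have "c \<le> ennreal (enn2real (E (u s)) + enn2real (E (v s)))"
          using \<tau>[OF \<open>0 < s\<close> \<open>s < \<tau>\<close>] D by (simp add: ennreal_plus flip: E_eq_ennreal)
        then show ?thesis by (intro enn2real_leI) auto
      qed
      ultimately show ?thesis by (simp add: \<kappa>_def)
    qed
    moreover have "\<forall>\<^sub>F r in at_right s. h r - h s \<le> (r - s) * (?qu r + ?qv r + \<kappa>)"
      using evr evDu evDv
    proof eventually_elim
      case (elim r)
      have expand: "(l2_norm M (\<lambda>x. k r x - f x))\<^sup>2 = (l2_norm M (\<lambda>x. k s x - f x))\<^sup>2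
          + 2 * ((r - s) * (l2_inner M (\<lambda>x. k s x - f x) (\<lambda>x. (k r x - k s x) / (r - s))
            + (r - s) * (l2_norm M (\<lambda>x. (k r x - k s x) / (r - s)))\<^sup>2 / 2))"
        if "(\<lambda>x. k s x - f x) \<in> L2 M" "(\<lambda>x. (k r x - k s x) / (r - s)) \<in> L2 M"
        for k :: "real \<Rightarrow> 'a \<Rightarrow> real" and f
      proof -
        have "(\<lambda>x. k r x - f x) = (\<lambda>x. (k s x - f x) + (r - s) * ((k r x - k s x) / (r - s)))"
          using elim(1) by simp
        moreover have "A + 2 * d * I + d\<^sup>2 * N = A + 2 * (d * (I + d * N / 2))" for A d I N :: real
          by (simp add: power2_eq_square algebra_simps)
        ultimately show ?thesis
          by (simp only: l2_norm_power2_add_cmult[OF that])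
      qed
      have "h r - h s = (r - s) * (?qu r + ?qv r + \<kappa>)"
        unfolding h_def expand[of u f, OF ufL elim(2)] expand[of v g, OF vgL elim(3)]
        by (simp add: algebra_simps add_divide_distrib diff_divide_distrib)
      then show ?case by simp
    qed
    ultimately show "\<exists>q l. (q \<longlongrightarrow> l) (at_right s) \<and> l \<le> 0 \<and>
        (\<forall>\<^sub>F r in at_right s. h r - h s \<le> (r - s) * q r)"
      by blast
  qed
  define b where "b = \<tau> / 2"
  have b: "0 < b" "b < \<tau>" using \<open>0 < \<tau>\<close> by (auto simp: b_def)
  have "(h \<longlongrightarrow> ((l2_norm M (\<lambda>x. ?y x - f x))\<^sup>2 + (l2_norm M (\<lambda>x. ?z x - g x))\<^sup>2) / 2 + \<kappa> * 0) (at_right 0)"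
    unfolding h_def
    by (intro tendsto_add tendsto_divide tendsto_power tendsto_mult tendsto_const tendsto_ident_at
        tendsto_l2_norm_diff[OF ev0(1) yL fL limy] tendsto_l2_norm_diff[OF ev0(2) zL gL limz]) simp
  then have lim: "(h \<longlongrightarrow> (l2_norm M ?w)\<^sup>2 / 4) (at_right 0)"
    unfolding yf zg by simp
  have "h b \<le> (l2_norm M ?w)\<^sup>2 / 4"
  proof (rule tendsto_lowerbound[OF lim])
    show "\<forall>\<^sub>F s in at_right 0. h b \<le> h s"
      unfolding eventually_at_right_field using b mono by (intro exI[of _ b]) auto
  qed simp
  \<comment> \<open>The constraint at time \<open>b\<close> forbids the gain
    \<open>\<kappa> * b\<close> claimed by the previous bound.\<close>
  moreover have "(l2_norm M ?w)\<^sup>2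
    \<le> 2 * ((l2_norm M (\<lambda>x. u b x - f x))\<^sup>2 + (l2_norm M (\<lambda>x. v b x - g x))\<^sup>2)"
    using b by (intro norm_power2_le_of_comp_eq_0 fL gL uL vL inv) auto
  moreover have "0 < \<kappa> * b" using \<open>0 < \<kappa>\<close> b by simp
  ultimately show False unfolding h_def by argo
qed

text \<open>The segment \<open>a\<close> runs from \<open>f - w\<close> to \<open>f\<close>, and
  \<open>b\<close> from \<open>g\<close> to \<open>g + w\<close>. The half inequality for the pair
  \<open>a (s + r)\<close>, \<open>b (s - r)\<close> moves both parameters to \<open>s\<close>. Such
  steps on a grid telescope, and lower semicontinuity reaches the end points \<open>a 0\<close> and
  \<open>b 1\<close>.\<close>

lemma half_contractive_imp_contractive:
  assumes half: "\<And>f g. f \<in> l2_domain M E \<Longrightarrow> g \<in> l2_domain M E \<Longrightarrow>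
    E (\<lambda>x. f x - 1/2 * \<phi> (f x - g x)) + E (\<lambda>x. g x + 1/2 * \<phi> (f x - g x)) \<le> E f + E g"
  shows "truncation_contractive M E \<phi>"
  unfolding truncation_contractive_def
proof (intro ballI)
  fix f g assume fL: "f \<in> L2 M" and gL: "g \<in> L2 M"
  let ?D = "l2_domain M E" and ?w = "\<lambda>x. \<phi> (f x - g x)"
  have wL: "?w \<in> L2 M" by (intro L2_comp L2_diff fL gL)
  define a where "a s = (\<lambda>x. f x - (1 - s) * ?w x)" for s
  define b where "b s = (\<lambda>x. g x + s * ?w x)" for s
  have aL: "a s \<in> L2 M" and bL: "b s \<in> L2 M" for s
    unfolding a_def b_def by (intro L2_intros fL gL wL)+
  show "E (\<lambda>x. f x - ?w x) + E (\<lambda>x. g x + ?w x) \<le> E f + E g"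
  proof (cases "f \<in> ?D \<and> g \<in> ?D")
    case False
    then have "E f + E g = top" using fL gL by (auto simp: l2_domain_def)
    then show ?thesis by (simp only: top_greatest)
  next
    case True
    then have a1: "a 1 \<in> ?D" and b0: "b 0 \<in> ?D" by (simp_all add: a_def b_def)
    have step: "a s \<in> ?D \<and> b s \<in> ?D \<and>
        enn2real (E (a s)) + enn2real (E (b s)) \<le> enn2real (E (a (s + r))) + enn2real (E (b (s - r)))"
      if r: "0 \<le> r" "r \<le> 1/2" and D: "a (s + r) \<in> ?D" "b (s - r) \<in> ?D" for s r
    proof -
      \<comment> \<open>The difference of the pair is \<open>f - g\<close> moved by
        \<open>(1 - 2 * r) * w\<close>, so \<open>scaling\<close> applies exactly when
        \<open>r\<close> is in \<open>[0, 1/2]\<close>; half of the resulting truncation is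
        \<open>r * w\<close>.\<close>
      have "\<phi> (a (s + r) x - b (s - r) x) = 2 * r * ?w x" for x
      proof -
        have "a (s + r) x - b (s - r) x = (f x - g x) - (1 - 2 * r) * ?w x"
          by (simp add: a_def b_def algebra_simps)
        then show ?thesis using r by (simp add: scaling)
      qed
      then have "a s = (\<lambda>x. a (s + r) x - 1/2 * \<phi> (a (s + r) x - b (s - r) x))"
        "b s = (\<lambda>x. b (s - r) x + 1/2 * \<phi> (a (s + r) x - b (s - r) x))"
        by (auto simp: a_def b_def algebra_simps)
      then have le: "E (a s) + E (b s) \<le> E (a (s + r)) + E (b (s - r))"
        using half[OF D] by simp
      also have sum: "\<dots> = ennreal (enn2real (E (a (s + r))) + enn2real (E (b (s - r))))"
        using D by (simp add: ennreal_plus flip: E_eq_ennreal)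
      finally have "E (a s) + E (b s) < \<infinity>" by (rule order.strict_trans1) simp
      then have D': "a s \<in> ?D" "b s \<in> ?D" using aL bL by (auto simp: l2_domain_def)
      then have "E (a s) + E (b s) = ennreal (enn2real (E (a s)) + enn2real (E (b s)))"
        by (simp add: ennreal_plus flip: E_eq_ennreal)
      with le sum D' show ?thesis by (simp flip: ennreal_plus)
    qed
    \<comment> \<open>Telescoping subtracts values of \<open>E\<close>, so their finiteness has to be known first.\<close>
    have dyadic: "a (1 / 2 ^ n) \<in> ?D \<and> b (1 - 1 / 2 ^ n) \<in> ?D" for n
    proof (induction n)
      case 0
      then show ?case using a1 b0 by simp
    next
      case (Suc n)
      define k :: real where "k = 1 / 2 ^ Suc n"
      have k: "0 \<le> k" "k \<le> 1/2" "k + k = 1 / 2 ^ n" by (auto simp: k_def field_simps)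
      \<comment> \<open>Two steps of width \<open>k\<close>: one from \<open>a (2 * k)\<close> and
        \<open>b 0\<close> to parameter \<open>k\<close>, the other from \<open>a 1\<close> and
        \<open>b (1 - 2 * k)\<close> to parameter \<open>1 - k\<close>.\<close>
      have "1 - k - k = 1 - 1 / 2 ^ n" using k(3) by linarith
      then have "a k \<in> ?D" "b (1 - k) \<in> ?D"
        using step[of k k] step[of k "1 - k"] k Suc.IH a1 b0 by simp_all
      then show ?case by (simp add: k_def)
    qed
    have seg: "a s \<in> ?D" "b (1 - s) \<in> ?D" if s: "1 / 2 ^ n \<le> s" "s \<le> 1" and "n > 0" for s n
    proof -
      define k :: real where "k = 1 / 2 ^ n"
      have "k < 1" using \<open>n > 0\<close> by (simp add: k_def)
      \<comment> \<open>The solution of \<open>s = (1 - t) * k + t\<close>; it uses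
        \<open>k < 1\<close>, hence \<open>n > 0\<close>.\<close>
      define t where "t = (s - k) / (1 - k)"
      have t: "0 \<le> t" "t \<le> 1" using s \<open>k < 1\<close> by (auto simp: t_def k_def[symmetric] field_simps)
      have "(1 - t) * (1 - k) = 1 - s" using \<open>k < 1\<close> by (simp add: t_def field_simps)
      then have *: "(1 - s) * y = (1 - t) * ((1 - k) * y)" for y by (simp flip: mult.assoc)
      have "(\<lambda>x. (1 - t) * a k x + t * a 1 x) \<in> ?D"
        using dyadic[of n] a1 t by (intro domain_convex) (auto simp: k_def)
      moreover have "a s = (\<lambda>x. (1 - t) * a k x + t * a 1 x)"
        unfolding a_def * by (auto simp: algebra_simps)
      ultimately show "a s \<in> ?D" by simp
      have "(\<lambda>x. (1 - t) * b (1 - k) x + t * b 0 x) \<in> ?D"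
        using dyadic[of n] b0 t by (intro domain_convex) (auto simp: k_def)
      moreover have "b (1 - s) = (\<lambda>x. (1 - t) * b (1 - k) x + t * b 0 x)"
        unfolding b_def * by (auto simp: algebra_simps)
      ultimately show "b (1 - s) \<in> ?D" by simp
    qed
    have bound: "E (a (1 / 2 ^ n)) + E (b (1 - 1 / 2 ^ n)) \<le> E f + E g" if "n > 0" for n
    proof -
      define N :: nat where "N = 2 ^ n"
      have N: "2 \<le> N" using \<open>n > 0\<close> self_le_power[of 2 n] by (simp add: N_def)
      have Nr: "real N = 2 ^ n" by (simp add: N_def)
      let ?\<alpha> = "\<lambda>i. enn2real (E (a (real i / real N)))" and ?\<beta> = "\<lambda>i. enn2real (E (b (real i / real N)))"
      have aD: "a (real i / real N) \<in> ?D" if "1 \<le> i" "i \<le> N" for i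
        using that N by (intro seg(1)[OF _ _ \<open>n > 0\<close>]) (auto simp: Nr[symmetric] divide_right_mono)
      have bD: "b (real i / real N) \<in> ?D" if "i < N" for i
      proof -
        have "b (1 - real (N - i) / real N) \<in> ?D"
          using that N by (intro seg(2)[OF _ _ \<open>n > 0\<close>]) (auto simp: Nr[symmetric] divide_right_mono)
        also have "1 - real (N - i) / real N = real i / real N"
          using that N by (simp add: of_nat_diff field_simps)
        finally show ?thesis .
      qed
      \<comment> \<open>The sum starts at \<open>?\<alpha> 1\<close> and ends at
        \<open>?\<beta> (N - 1)\<close>: finiteness at \<open>a 0\<close> and \<open>b 1\<close> is
        not yet known. Each step adds the half inequality at the grid point \<open>k + 1\<close> and
        cancels \<open>?\<alpha> (k + 1)\<close> and \<open>?\<beta> k\<close>.\<close>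
      have "?\<alpha> 1 + ?\<beta> k \<le> ?\<alpha> (Suc k) + ?\<beta> 0" if "k < N" for k
        using that
      proof (induction k)
        case 0
        then show ?case by simp
      next
        case (Suc k)
        define s where "s = real (Suc k) / real N"
        define r where "r = 1 / real N"
        have r: "0 \<le> r" "r \<le> 1/2" using N by (auto simp: r_def field_simps)
        have sr: "s + r = real (Suc (Suc k)) / real N" "s - r = real k / real N"
          by (simp_all add: s_def r_def add_divide_distrib)
        have "enn2real (E (a s)) + enn2real (E (b s))
            \<le> enn2real (E (a (s + r))) + enn2real (E (b (s - r)))"
          using step[OF r, of s] aD[of "Suc (Suc k)"] bD[of k] Suc.prems unfolding sr by simp
        from this[unfolded sr, unfolded s_def] show ?case using Suc by simp
      qed
      from this[of "N - 1"] have "?\<alpha> 1 + ?\<beta> (N - 1) \<le> ?\<alpha> N + ?\<beta> 0" using N by simp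
      moreover have "real 1 / real N = 1 / 2 ^ n" "real (N - 1) / real N = 1 - 1 / 2 ^ n"
        "a (real N / real N) = f" "b (real 0 / real N) = g"
        using N by (auto simp: Nr of_nat_diff field_simps a_def b_def)
      ultimately have le: "enn2real (E (a (1 / 2 ^ n))) + enn2real (E (b (1 - 1 / 2 ^ n)))
          \<le> enn2real (E f) + enn2real (E g)"
        by simp
      have "E (a (1 / 2 ^ n)) + E (b (1 - 1 / 2 ^ n))
          = ennreal (enn2real (E (a (1 / 2 ^ n))) + enn2real (E (b (1 - 1 / 2 ^ n))))"
        using dyadic[of n] by (simp add: ennreal_plus flip: E_eq_ennreal)
      also have "\<dots> \<le> ennreal (enn2real (E f) + enn2real (E g))"
        using le by (rule ennreal_leI)
      also have "\<dots> = E f + E g"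
        using True by (simp add: ennreal_plus flip: E_eq_ennreal)
      finally show ?thesis .
    qed
    have lim: "(\<lambda>n. c * (1 / 2 ^ n)) \<longlonglongrightarrow> 0" for c :: real
      using tendsto_mult_left[OF LIMSEQ_power_zero[of "1/2 :: real"], of c]
      by (simp add: power_one_over)
    have "(\<lambda>x. a (1 / 2 ^ n) x - a 0 x) = (\<lambda>x. 1 / 2 ^ n * ?w x)"
      "(\<lambda>x. b (1 - 1 / 2 ^ n) x - b 1 x) = (\<lambda>x. (- (1 / 2 ^ n)) * ?w x)" for n :: nat
      by (auto simp: a_def b_def algebra_simps)
    then have "l2_norm M (\<lambda>x. a (1 / 2 ^ n) x - a 0 x) = l2_norm M ?w * (1 / 2 ^ n)"
      "l2_norm M (\<lambda>x. b (1 - 1 / 2 ^ n) x - b 1 x) = l2_norm M ?w * (1 / 2 ^ n)" for n :: nat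
      by (simp_all only: l2_norm_cmult) simp_all
    then have la: "(\<lambda>n. l2_norm M (\<lambda>x. a (1 / 2 ^ n) x - a 0 x)) \<longlonglongrightarrow> 0"
      and lb: "(\<lambda>n. l2_norm M (\<lambda>x. b (1 - 1 / 2 ^ n) x - b 1 x)) \<longlonglongrightarrow> 0"
      using lim[of "l2_norm M ?w"] by (simp_all only:)
    have "E (a 0) + E (b 1) \<le> E f + E g"
    proof (rule ccontr)
      assume "\<not> E (a 0) + E (b 1) \<le> E f + E g"
      then have less: "E f + E g < E (a 0) + E (b 1)" by simp
      have "\<forall>\<^sub>F n in sequentially. E f + E g < E (a (1 / 2 ^ n)) + E (b (1 - 1 / 2 ^ n))"
        by (rule l2_lsc_eventually_add[where E = E and y = "a 0" and z = "b 1"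
              and u = "\<lambda>n. a (1 / 2 ^ n)" and v = "\<lambda>n. b (1 - 1 / 2 ^ n)", OF lsc aL bL _ _ la lb less])
          (simp_all add: aL bL)
      then have "\<forall>\<^sub>F n in sequentially. False"
        using eventually_gt_at_top[of 0] by eventually_elim (use bound in \<open>simp add: leD\<close>)
      then show False by simp
    qed
    then show ?thesis by (simp add: a_def b_def)
  qed
qed

end

section \<open>Invariance under the semigroup\<close>

lemma semigroup_gradient_flow:
  assumes "gradient_flow_well_posed M E" "f \<in> L2 M"
  shows "gradient_flow M E f (\<lambda>t. semigroup M E t f)"
proof -
  have "\<exists>u. gradient_flow M E f u"
    using assms by (simp add: gradient_flow_well_posed_def)
  then show ?thesis unfolding semigroup_def by (rule someI_ex)
qed

text \<open>For the converse, invariance is applied to the pair \<open>?y\<close>,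
  \<open>?z\<close>, which satisfies the constraint by \<open>scaling\<close> with factor 1.\<close>

theorem (in truncated_functional) truncation_contractive_iff_semigroup_invariant:
  assumes wp: "gradient_flow_well_posed M E"
  shows "truncation_contractive M E \<phi> \<longleftrightarrow>
    (\<forall>t\<ge>0. \<forall>f\<in>L2 M. \<forall>g\<in>L2 M. (AE x in M. \<phi> (f x - g x) = 0) \<longrightarrow>
      (AE x in M. \<phi> (semigroup M E t f x - semigroup M E t g x) = 0))"
    (is "_ \<longleftrightarrow> ?inv")
proof
  assume C: "truncation_contractive M E \<phi>"
  show ?inv
  proof (intro allI impI ballI)
    fix t :: real and f g
    assume "0 \<le> t" "f \<in> L2 M" "g \<in> L2 M" "AE x in M. \<phi> (f x - g x) = 0"
    then show "AE x in M. \<phi> (semigroup M E t f x - semigroup M E t g x) = 0"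
      by (intro contractive_imp_flow_invariant[OF C _ _
            semigroup_gradient_flow[OF wp] semigroup_gradient_flow[OF wp]])
  qed
next
  assume inv: ?inv
  show "truncation_contractive M E \<phi>"
  proof (rule half_contractive_imp_contractive)
    fix f g assume D: "f \<in> l2_domain M E" "g \<in> l2_domain M E"
    let ?y = "\<lambda>x. f x - 1/2 * \<phi> (f x - g x)" and ?z = "\<lambda>x. g x + 1/2 * \<phi> (f x - g x)"
    have fL: "f \<in> L2 M" and gL: "g \<in> L2 M" using D by (auto dest: domain_L2)
    then have wL: "(\<lambda>x. \<phi> (f x - g x)) \<in> L2 M" by (intro L2_comp L2_diff)
    have yL: "?y \<in> L2 M" and zL: "?z \<in> L2 M"
      by (intro L2_diff L2_add L2_cmult fL gL wL)+
    have "\<phi> (?y x - ?z x) = 0" for x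
    proof -
      have "?y x - ?z x = (f x - g x) - 1 * \<phi> (f x - g x)" by simp
      then show ?thesis using scaling[of 1 "f x - g x"] by simp
    qed
    then have ae: "AE x in M. \<phi> (?y x - ?z x) = 0" by simp
    have "AE x in M. \<phi> (semigroup M E t ?y x - semigroup M E t ?z x) = 0" if "0 < t" for t
      by (rule inv[rule_format]) (rule less_imp_le[OF that] yL zL ae)+
    then show "E ?y + E ?z \<le> E f + E g"
      by (rule flow_invariant_imp_half_contractive[OF D
            semigroup_gradient_flow[OF wp yL] semigroup_gradient_flow[OF wp zL]])
  qed
qed

subsection \<open>Order preservation and uniform contraction\<close>

text \<open>The third assumption is the variational inequality of the projection \<open>d - \<phi>(d)\<close>.\<close>

lemma soft_truncationI:
  fixes \<phi> :: "real \<Rightarrow> real"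
  assumes "\<phi> 0 = 0" "\<And>a b. \<bar>\<phi> a - \<phi> b\<bar> \<le> \<bar>a - b\<bar>"
    and "\<And>a b. \<phi> b * ((a - \<phi> a) - (b - \<phi> b)) \<le> 0"
    and "\<And>r a. 0 \<le> r \<Longrightarrow> r \<le> 1 \<Longrightarrow> \<phi> (a - r * \<phi> a) = (1 - r) * \<phi> a"
  shows "soft_truncation \<phi>"
proof
  fix a b
  have "0 \<le> (\<phi> a - \<phi> b)\<^sup>2" by simp
  then show "(\<phi> b)\<^sup>2 / 2 + \<phi> b * (a - b) \<le> (\<phi> a)\<^sup>2 / 2"
    using assms(3)[of b a] by (simp add: power2_eq_square algebra_simps)
qed (use assms in auto)

lemma soft_truncation_pos_part: "soft_truncation (\<lambda>d. max d 0)"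
proof (rule soft_truncationI)
  fix r a :: real assume "0 \<le> r" "r \<le> 1"
  then show "max (a - r * max a 0) 0 = (1 - r) * max a 0"
    using mult_left_le_one_le[of a r] by (cases "0 \<le> a") (auto simp: max_def algebra_simps)
next
  fix a b :: real
  show "max b 0 * ((a - max a 0) - (b - max b 0)) \<le> 0"
  proof (cases "0 < b")
    case True
    then show ?thesis by (intro mult_nonneg_nonpos) auto
  qed simp
qed auto

text \<open>The signed excess of \<open>d\<close> over \<open>[-\<alpha>, \<alpha>]\<close>, that
  is, \<open>d\<close> minus its projection onto this interval; the case split is that of
  \<open>H\<close>.\<close>

definition soft_threshold :: "real \<Rightarrow> real \<Rightarrow> real" where
  "soft_threshold \<alpha> d = (if d < - \<alpha> then d + \<alpha> else if d \<le> \<alpha> then 0 else d - \<alpha>)"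

lemma soft_truncation_soft_threshold:
  assumes "0 \<le> \<alpha>"
  shows "soft_truncation (soft_threshold \<alpha>)"
proof (rule soft_truncationI)
  fix r a :: real assume r: "0 \<le> r" "r \<le> 1"
  consider "a < - \<alpha>" | "- \<alpha> \<le> a" "a \<le> \<alpha>" | "\<alpha> < a" by linarith
  then show "soft_threshold \<alpha> (a - r * soft_threshold \<alpha> a) = (1 - r) * soft_threshold \<alpha> a"
  proof cases
    case 1
    \<comment> \<open>The shift multiplies the excess by \<open>1 - r\<close> and does not change
      its side.\<close>
    then have eq: "a - r * soft_threshold \<alpha> a = - \<alpha> + (1 - r) * (a + \<alpha>)"
      by (simp add: soft_threshold_def algebra_simps)
    have "(1 - r) * (a + \<alpha>) \<le> 0" using r 1 by (intro mult_nonneg_nonpos) auto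
    then show ?thesis unfolding eq using 1 assms
      by (auto simp: soft_threshold_def)
  next
    case 2
    then show ?thesis using assms by (simp add: soft_threshold_def)
  next
    case 3
    then have eq: "a - r * soft_threshold \<alpha> a = \<alpha> + (1 - r) * (a - \<alpha>)"
      using assms by (simp add: soft_threshold_def algebra_simps)
    have "0 \<le> (1 - r) * (a - \<alpha>)" using r 3 by (intro mult_nonneg_nonneg) auto
    then show ?thesis unfolding eq using 3 assms
      by (auto simp: soft_threshold_def)
  qed
next
  fix a b :: real
  consider "b < - \<alpha>" | "- \<alpha> \<le> b" "b \<le> \<alpha>" | "\<alpha> < b" by linarith
  then show "soft_threshold \<alpha> b * ((a - soft_threshold \<alpha> a) - (b - soft_threshold \<alpha> b)) \<le> 0"
  proof cases
    case 1
    then show ?thesis using assms by (intro mult_nonpos_nonneg) (auto simp: soft_threshold_def)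
  next
    case 2
    then show ?thesis by (simp add: soft_threshold_def)
  next
    case 3
    then show ?thesis using assms by (intro mult_nonneg_nonpos) (auto simp: soft_threshold_def)
  qed
qed (use assms in \<open>auto simp: soft_threshold_def\<close>)

lemma soft_threshold_eq_0_iff: "0 \<le> \<alpha> \<Longrightarrow> soft_threshold \<alpha> d = 0 \<longleftrightarrow> \<bar>d\<bar> \<le> \<alpha>"
  by (auto simp: soft_threshold_def)

text \<open>\<open>soft_threshold \<alpha>\<close> is odd, so exchanging \<open>f\<close> and
  \<open>g\<close> only changes the sign of the correction.\<close>

lemma H_eq_soft_threshold:
  assumes "0 \<le> \<alpha>"
  shows "H \<alpha> f g = (\<lambda>x. f x - soft_threshold \<alpha> (f x - g x))"
    and "H \<alpha> g f = (\<lambda>x. g x + soft_threshold \<alpha> (f x - g x))"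
  using assms by (auto simp: H_def soft_threshold_def)

lemma truncation_contractive_pos_part_iff:
  "truncation_contractive M E (\<lambda>d. max d 0) \<longleftrightarrow>
    (\<forall>f\<in>L2 M. \<forall>g\<in>L2 M. E (\<lambda>x. max (f x) (g x)) + E (\<lambda>x. min (f x) (g x)) \<le> E f + E g)"
proof -
  have "(\<lambda>x. f x - max (f x - g x) 0) = (\<lambda>x. min (f x) (g x))"
    "(\<lambda>x. g x + max (f x - g x) 0) = (\<lambda>x. max (f x) (g x))" for f g :: "'a \<Rightarrow> real"
    by (auto simp: max_def min_def)
  then show ?thesis by (simp add: truncation_contractive_def add.commute)
qed

lemma truncation_contractive_soft_threshold_iff:
  assumes "0 \<le> \<alpha>"
  shows "truncation_contractive M E (soft_threshold \<alpha>) \<longleftrightarrow>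
    (\<forall>f\<in>L2 M. \<forall>g\<in>L2 M. E (H \<alpha> f g) + E (H \<alpha> g f) \<le> E f + E g)"
proof -
  have "E (H \<alpha> f g) + E (H \<alpha> g f) = E (\<lambda>x. f x - soft_threshold \<alpha> (f x - g x)) +
      E (\<lambda>x. g x + soft_threshold \<alpha> (f x - g x))" for f g
    by (subst H_eq_soft_threshold(2)[OF assms, of g f], subst H_eq_soft_threshold(1)[OF assms, of f g])
      (rule refl)
  then show ?thesis by (simp only: truncation_contractive_def)
qed

section \<open>Contraction in the essential supremum norm\<close>

lemma linf_norm_le_iff:
  assumes "f \<in> borel_measurable M" "0 \<le> \<alpha>"
  shows "linf_norm M f \<le> ennreal \<alpha> \<longleftrightarrow> (AE x in M. \<bar>f x\<bar> \<le> \<alpha>)"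
proof
  assume le: "linf_norm M f \<le> ennreal \<alpha>"
  have "AE x in M. ennreal \<bar>f x\<bar> \<le> linf_norm M f"
    unfolding linf_norm_def by (rule esssup_AE)
  then show "AE x in M. \<bar>f x\<bar> \<le> \<alpha>"
  proof eventually_elim
    case (elim x)
    then have "ennreal \<bar>f x\<bar> \<le> ennreal \<alpha>" using le by (rule order_trans)
    then show ?case using assms(2) by simp
  qed
next
  assume "AE x in M. \<bar>f x\<bar> \<le> \<alpha>"
  then have "AE x in M. ennreal \<bar>f x\<bar> \<le> ennreal \<alpha>"
    by eventually_elim (rule ennreal_leI)
  then show "linf_norm M f \<le> ennreal \<alpha>"
    unfolding linf_norm_def using assms(1) by (intro esssup_I) auto
qed

text \<open>Contraction amounts to preserving each bound by a real level \<open>\<alpha>\<close>.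
  The level to use is the norm of \<open>f - g\<close>; if it is infinite, there is nothing to
  show.\<close>

lemma linf_contraction_on_L2_iff:
  assumes S: "\<And>f. f \<in> L2 M \<Longrightarrow> S f \<in> L2 M"
  shows "linf_contraction_on_L2 M S \<longleftrightarrow>
    (\<forall>\<alpha>\<ge>0. \<forall>f\<in>L2 M. \<forall>g\<in>L2 M. (AE x in M. \<bar>f x - g x\<bar> \<le> \<alpha>) \<longrightarrow>
      (AE x in M. \<bar>S f x - S g x\<bar> \<le> \<alpha>))"
    (is "_ \<longleftrightarrow> ?R")
proof -
  have meas: "(\<lambda>x. f x - g x) \<in> borel_measurable M" if "f \<in> L2 M" "g \<in> L2 M" for f g
    using that by (intro L2_measurable L2_diff)
  show ?thesis
  proof
    assume L: "linf_contraction_on_L2 M S"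
    show ?R
    proof (intro allI impI ballI)
      fix \<alpha> :: real and f g
      assume \<alpha>: "0 \<le> \<alpha>" and fg: "f \<in> L2 M" "g \<in> L2 M" and "AE x in M. \<bar>f x - g x\<bar> \<le> \<alpha>"
      then have "linf_norm M (\<lambda>x. f x - g x) \<le> ennreal \<alpha>"
        using linf_norm_le_iff[OF meas[OF fg] \<alpha>] by simp
      moreover have "linf_norm M (\<lambda>x. S f x - S g x) \<le> linf_norm M (\<lambda>x. f x - g x)"
        using L fg by (simp add: linf_contraction_on_L2_def)
      ultimately have "linf_norm M (\<lambda>x. S f x - S g x) \<le> ennreal \<alpha>" by (rule order_trans[rotated])
      then show "AE x in M. \<bar>S f x - S g x\<bar> \<le> \<alpha>"
        using linf_norm_le_iff[OF meas[OF S[OF fg(1)] S[OF fg(2)]] \<alpha>] by simp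
    qed
  next
    assume R: ?R
    show "linf_contraction_on_L2 M S"
      unfolding linf_contraction_on_L2_def
    proof (intro ballI)
      fix f g assume fg: "f \<in> L2 M" "g \<in> L2 M"
      show "linf_norm M (\<lambda>x. S f x - S g x) \<le> linf_norm M (\<lambda>x. f x - g x)"
      proof (cases "linf_norm M (\<lambda>x. f x - g x)")
        case (real \<alpha>)
        then have "AE x in M. \<bar>f x - g x\<bar> \<le> \<alpha>"
          using linf_norm_le_iff[OF meas[OF fg], of \<alpha>] by simp
        then have "AE x in M. \<bar>S f x - S g x\<bar> \<le> \<alpha>"
          using R fg real(1) by blast
        then show ?thesis
          using linf_norm_le_iff[OF meas[OF S[OF fg(1)] S[OF fg(2)]] real(1)] real(2) by simp
      qed simp
    qed
  qed
qed

subsection \<open>Convexity\<close>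

text \<open>Truncating the pair replaces \<open>d = f - g\<close> by
  \<open>d - 2 * soft_threshold \<alpha> d\<close>, which reflects the part beyond
  \<open>\<alpha>\<close> back: it maps \<open>[-2\<alpha>, 2\<alpha>]\<close> into
  \<open>[-\<alpha>, \<alpha>]\<close> and never increases the absolute value.\<close>

lemma exists_contracted_pair:
  assumes C: "\<And>\<alpha>. 0 \<le> \<alpha> \<Longrightarrow> truncation_contractive M E (soft_threshold \<alpha>)"
    and "f \<in> L2 M" "g \<in> L2 M" "0 \<le> K"
  shows "\<exists>f'\<in>L2 M. \<exists>g'\<in>L2 M. (\<forall>x. f' x + g' x = f x + g x) \<and> E f' + E g' \<le> E f + E g \<and>
    (\<forall>x. \<bar>f' x - g' x\<bar> \<le> \<bar>f x - g x\<bar>) \<and> (\<forall>x. \<bar>f x - g x\<bar> \<le> K \<longrightarrow> \<bar>f' x - g' x\<bar> \<le> K / 2 ^ n)"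
proof (induction n)
  case 0
  then show ?case using assms(2,3) by (intro bexI[of _ f] bexI[of _ g]) auto
next
  case (Suc n)
  then obtain f' g' where L: "f' \<in> L2 M" "g' \<in> L2 M" and sum: "\<And>x. f' x + g' x = f x + g x"
    and E: "E f' + E g' \<le> E f + E g" and le: "\<And>x. \<bar>f' x - g' x\<bar> \<le> \<bar>f x - g x\<bar>"
    and K: "\<And>x. \<bar>f x - g x\<bar> \<le> K \<Longrightarrow> \<bar>f' x - g' x\<bar> \<le> K / 2 ^ n"
    by blast
  define \<alpha> where "\<alpha> = K / 2 ^ Suc n"
  have \<alpha>: "0 \<le> \<alpha>" "K / 2 ^ n = 2 * \<alpha>" using \<open>0 \<le> K\<close> by (auto simp: \<alpha>_def)
  interpret soft_truncation "soft_threshold \<alpha>"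
    using \<alpha>(1) by (rule soft_truncation_soft_threshold)
  let ?w = "\<lambda>x. soft_threshold \<alpha> (f' x - g' x)"
  let ?f = "\<lambda>x. f' x - ?w x" and ?g = "\<lambda>x. g' x + ?w x"
  have fg: "?f \<in> L2 M" "?g \<in> L2 M" by (intro L2_diff L2_add L2_comp L)+
  have sum': "?f x + ?g x = f x + g x" for x using sum[of x] by simp
  have E': "E ?f + E ?g \<le> E f + E g"
    using C[OF \<alpha>(1)] L E unfolding truncation_contractive_def by (blast intro: order_trans)
  have "\<bar>?f x - ?g x\<bar> \<le> \<bar>f' x - g' x\<bar>" for x
    using \<alpha>(1) by (auto simp: soft_threshold_def)
  then have le': "\<bar>?f x - ?g x\<bar> \<le> \<bar>f x - g x\<bar>" for x using le order_trans by blast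
  have K': "\<bar>?f x - ?g x\<bar> \<le> K / 2 ^ Suc n" if "\<bar>f x - g x\<bar> \<le> K" for x
    using K[OF that] unfolding \<alpha>(2) \<alpha>_def[symmetric] by (auto simp: soft_threshold_def)
  show ?case
    by (intro bexI[of _ ?f] bexI[of _ ?g] conjI allI impI fg sum' E' le' K')
qed

text \<open>Contracted pairs with constant sum converge to the midpoint in norm by dominated
  convergence, with majorant \<open>(f - g)\<^sup>2\<close>; lower semicontinuity passes to the
  limit.\<close>

lemma soft_threshold_contractive_imp_midpoint_convex:
  assumes lsc: "l2_lsc M E"
    and C: "\<And>\<alpha>. 0 \<le> \<alpha> \<Longrightarrow> truncation_contractive M E (soft_threshold \<alpha>)"
    and f: "f \<in> L2 M" and g: "g \<in> L2 M"
  shows "E (\<lambda>x. (f x + g x) / 2) + E (\<lambda>x. (f x + g x) / 2) \<le> E f + E g"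
proof (rule ccontr)
  let ?m = "\<lambda>x. (f x + g x) / 2"
  have mL: "?m \<in> L2 M" by (intro L2_divide L2_add f g)
  \<comment> \<open>As \<open>f - g\<close> may be unbounded, the level \<open>2 ^ n\<close> grows
    so that each point is eventually covered; \<open>2 * n\<close> foldings still bring the
    difference below \<open>2 ^ - n\<close> there.\<close>
  have "\<forall>n. \<exists>f' g'. f' \<in> L2 M \<and> g' \<in> L2 M \<and> (\<forall>x. f' x + g' x = f x + g x) \<and>
      E f' + E g' \<le> E f + E g \<and> (\<forall>x. \<bar>f' x - g' x\<bar> \<le> \<bar>f x - g x\<bar>) \<and>
      (\<forall>x. \<bar>f x - g x\<bar> \<le> 2 ^ n \<longrightarrow> \<bar>f' x - g' x\<bar> \<le> 2 ^ n / 2 ^ (2 * n))"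
    using exists_contracted_pair[OF C f g] by (metis zero_le_power zero_le_numeral)
  then obtain F G where L: "\<And>n. F n \<in> L2 M" "\<And>n. G n \<in> L2 M"
    and sum: "\<And>n x. F n x + G n x = f x + g x" and E: "\<And>n. E (F n) + E (G n) \<le> E f + E g"
    and le: "\<And>n x. \<bar>F n x - G n x\<bar> \<le> \<bar>f x - g x\<bar>"
    and small: "\<And>n x. \<bar>f x - g x\<bar> \<le> 2 ^ n \<Longrightarrow> \<bar>F n x - G n x\<bar> \<le> 2 ^ n / 2 ^ (2 * n)"
    by metis
  have ptw: "(\<lambda>n. F n x - G n x) \<longlonglongrightarrow> 0" for x
  proof (rule Lim_null_comparison)
    show "\<forall>\<^sub>F n in sequentially. norm (F n x - G n x) \<le> (1 / 2) ^ n"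
    proof -
      obtain N :: nat where N: "\<bar>f x - g x\<bar> \<le> 2 ^ N"
        using real_arch_pow[of 2 "\<bar>f x - g x\<bar>"] by (auto intro: less_imp_le)
      have "norm (F n x - G n x) \<le> (1 / 2) ^ n" if "N \<le> n" for n
      proof -
        have "(2::real) ^ N \<le> 2 ^ n" using that by (rule power_increasing) simp
        with N have "\<bar>f x - g x\<bar> \<le> 2 ^ n" by (rule order_trans)
        from small[OF this] show ?thesis by (simp add: power_one_over mult_2 power_add)
      qed
      then show ?thesis by (auto simp: eventually_sequentially)
    qed
    show "(\<lambda>n. (1 / 2 :: real) ^ n) \<longlonglongrightarrow> 0" by (rule LIMSEQ_power_zero) simp
  qed
  have "(\<lambda>n. LINT x|M. (F n x - G n x)\<^sup>2) \<longlonglongrightarrow> (LINT x|M. 0)"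
  proof (rule integral_dominated_convergence)
    show "integrable M (\<lambda>x. (f x - g x)\<^sup>2)" using L2_diff[OF f g] by (simp add: L2_def)
    show "(\<lambda>x. (F n x - G n x)\<^sup>2) \<in> borel_measurable M" for n
      using L2_diff[OF L] by (auto simp: L2_def)
    show "AE x in M. (\<lambda>n. (F n x - G n x)\<^sup>2) \<longlonglongrightarrow> 0"
      using tendsto_power[OF ptw, where n = 2] by simp
    show "AE x in M. norm ((F n x - G n x)\<^sup>2) \<le> (f x - g x)\<^sup>2" for n
      using le[of n] by (simp add: abs_le_square_iff)
  qed simp
  then have "(\<lambda>n. (l2_norm M (\<lambda>x. F n x - G n x))\<^sup>2) \<longlonglongrightarrow> 0"
    by (simp add: l2_norm_power2_eq_integral)
  then have "(\<lambda>n. l2_norm M (\<lambda>x. F n x - G n x)) \<longlonglongrightarrow> 0"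
    by simp
  from tendsto_mult_left[OF this, of "1/2"]
  have lim: "(\<lambda>n. 1 / 2 * l2_norm M (\<lambda>x. F n x - G n x)) \<longlonglongrightarrow> 0" by simp
  have "(\<lambda>x. F n x - ?m x) = (\<lambda>x. 1 / 2 * (F n x - G n x))"
    "(\<lambda>x. G n x - ?m x) = (\<lambda>x. (- 1 / 2) * (F n x - G n x))" for n
    using sum[of n, symmetric] by (auto simp: field_simps)
  then have "l2_norm M (\<lambda>x. F n x - ?m x) = 1 / 2 * l2_norm M (\<lambda>x. F n x - G n x)"
    "l2_norm M (\<lambda>x. G n x - ?m x) = 1 / 2 * l2_norm M (\<lambda>x. F n x - G n x)" for n
    by (simp_all only: l2_norm_cmult)
  then have lF: "(\<lambda>n. l2_norm M (\<lambda>x. F n x - ?m x)) \<longlonglongrightarrow> 0"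
    and lG: "(\<lambda>n. l2_norm M (\<lambda>x. G n x - ?m x)) \<longlonglongrightarrow> 0"
    using lim by (simp_all only:)
  assume "\<not> E ?m + E ?m \<le> E f + E g"
  then have less: "E f + E g < E ?m + E ?m" by simp
  have "\<forall>\<^sub>F n in sequentially. E f + E g < E (F n) + E (G n)"
    by (rule l2_lsc_eventually_add[where E = E and y = ?m and z = ?m and u = F and v = G,
          OF lsc mL mL _ _ lF lG less]) (simp_all add: L)
  then have "\<forall>\<^sub>F n in sequentially. False"
    by eventually_elim (use E in \<open>simp add: leD\<close>)
  then show False by simp
qed

text \<open>A missing \<open>t\<close> lies in a gap whose end points \<open>a\<close> and
  \<open>b\<close> belong to the closed set, but their midpoint would lie inside the gap.\<close>

lemma closed_midpoint_closed_unit_interval: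
  fixes S :: "real set"
  assumes "closed S" "0 \<in> S" "1 \<in> S" and mid: "\<And>s t. s \<in> S \<Longrightarrow> t \<in> S \<Longrightarrow> (s + t) / 2 \<in> S"
  shows "{0..1} \<subseteq> S"
proof
  fix t :: real assume t: "t \<in> {0..1}"
  show "t \<in> S"
  proof (rule ccontr)
    assume "t \<notin> S"
    define a where "a = Sup (S \<inter> {..t})"
    define b where "b = Inf (S \<inter> {t..})"
    have "a \<in> S \<inter> {..t}"
      unfolding a_def using assms t by (intro closed_contains_Sup closed_Int) auto
    moreover have "b \<in> S \<inter> {t..}"
      unfolding b_def using assms t by (intro closed_contains_Inf closed_Int) auto
    ultimately have ab: "a \<in> S" "b \<in> S" "a < t" "t < b"
      using \<open>t \<notin> S\<close> by (auto simp: less_le)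
    have m: "(a + b) / 2 \<in> S" using ab by (intro mid)
    show False
    proof (cases "(a + b) / 2 \<le> t")
      case True
      then have "(a + b) / 2 \<le> a" unfolding a_def using m by (intro cSup_upper) (auto simp: a_def)
      then show False using ab by simp
    next
      case False
      then have "b \<le> (a + b) / 2" unfolding b_def using m by (intro cInf_lower) (auto simp: b_def)
      then show False using ab by simp
    qed
  qed
qed

text \<open>For finite end values, the parameters at which the convexity inequality holds form a
  closed set, by lower semicontinuity, that is stable under midpoints and contains 0 and 1.\<close>

lemma midpoint_convex_imp_l2_convex:
  assumes lsc: "l2_lsc M E"
    and mid: "\<And>f g. f \<in> L2 M \<Longrightarrow> g \<in> L2 M \<Longrightarrow>
      E (\<lambda>x. (f x + g x) / 2) + E (\<lambda>x. (f x + g x) / 2) \<le> E f + E g"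
  shows "l2_convex M E"
  unfolding l2_convex_def
proof (intro ballI)
  fix f g and t :: real assume f: "f \<in> L2 M" and g: "g \<in> L2 M" and t: "t \<in> {0..1}"
  show "E (\<lambda>x. (1 - t) * f x + t * g x) \<le> ennreal (1 - t) * E f + ennreal t * E g"
  proof (cases "E f = top \<or> E g = top")
    case True
    \<comment> \<open>At an end point an infinite value may carry the weight 0, and that product is
      0 in \<open>ennreal\<close>, so only interior \<open>t\<close> make the right side
      infinite.\<close>
    consider "t = 0" | "t = 1" | "0 < t" "t < 1" using t by fastforce
    then show ?thesis
    proof cases
      case 3
      then have "ennreal (1 - t) * E f + ennreal t * E g = top"
        using True by (auto simp: ennreal_mult_top ennreal_mult_eq_top_iff)
      then show ?thesis by (simp only: top_greatest)
    qed simp_all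
  next
    case False
    then obtain a b where a: "0 \<le> a" "E f = ennreal a" and b: "0 \<le> b" "E g = ennreal b"
      by (cases "E f"; cases "E g") auto
    define \<gamma> where "\<gamma> s = (\<lambda>x. (1 - s) * f x + s * g x)" for s
    define l where "l s = (1 - s) * a + s * b" for s :: real
    define S where "S = {s \<in> {0..1}. E (\<gamma> s) \<le> ennreal (l s)}"
    have \<gamma>L: "\<gamma> s \<in> L2 M" for s unfolding \<gamma>_def by (intro L2_add L2_cmult f g)
    have l_nonneg: "0 \<le> l s" if "s \<in> {0..1}" for s
      using that a b by (auto simp: l_def)
    have "closed S"
    unfolding closed_sequential_limits
    proof (intro allI impI, elim conjE)
      fix s :: "nat \<Rightarrow> real" and r assume s: "\<forall>n. s n \<in> S" and lim: "s \<longlonglongrightarrow> r"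
      have r: "r \<in> {0..1}"
        by (rule closed_sequentially[OF _ _ lim]) (use s in \<open>auto simp: S_def\<close>)
      have "E (\<gamma> r) \<le> ennreal (l r)"
      proof (rule ccontr)
        assume "\<not> E (\<gamma> r) \<le> ennreal (l r)"
        then obtain c where c: "ennreal (l r) < c" "c < E (\<gamma> r)"
          using dense[of "ennreal (l r)"] by (auto simp: not_le)
        obtain \<delta> where "\<delta> > 0" and \<delta>: "\<And>h. h \<in> L2 M \<Longrightarrow> l2_norm M (\<lambda>x. h x - \<gamma> r x) < \<delta> \<Longrightarrow> c < E h"
          using lsc \<gamma>L[of r] c(2) unfolding l2_lsc_def by blast
        have "l2_norm M (\<lambda>x. \<gamma> (s n) x - \<gamma> r x) = \<bar>s n - r\<bar> * l2_norm M (\<lambda>x. g x - f x)" for n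
        proof -
          have "(\<lambda>x. \<gamma> (s n) x - \<gamma> r x) = (\<lambda>x. (s n - r) * (g x - f x))"
            by (auto simp: \<gamma>_def algebra_simps)
          then show ?thesis by (simp only: l2_norm_cmult)
        qed
        moreover have "(\<lambda>n. \<bar>s n - r\<bar> * l2_norm M (\<lambda>x. g x - f x)) \<longlonglongrightarrow> \<bar>r - r\<bar> * l2_norm M (\<lambda>x. g x - f x)"
          by (intro tendsto_intros lim)
        ultimately have "(\<lambda>n. l2_norm M (\<lambda>x. \<gamma> (s n) x - \<gamma> r x)) \<longlonglongrightarrow> 0" by simp
        then have "\<forall>\<^sub>F n in sequentially. l2_norm M (\<lambda>x. \<gamma> (s n) x - \<gamma> r x) < \<delta>"
          using \<open>\<delta> > 0\<close> by (rule order_tendstoD(2))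
        then have ev: "\<forall>\<^sub>F n in sequentially. c \<le> ennreal (l (s n))"
        proof eventually_elim
          case (elim n)
          then have "c < E (\<gamma> (s n))" using \<gamma>L by (intro \<delta>)
          also have "\<dots> \<le> ennreal (l (s n))" using s by (simp add: S_def)
          finally show ?case by simp
        qed
        have "(\<lambda>n. ennreal (l (s n))) \<longlonglongrightarrow> ennreal (l r)"
          unfolding l_def by (intro tendsto_ennrealI tendsto_intros lim)
        then have "c \<le> ennreal (l r)"
          using ev by (rule tendsto_lowerbound) simp
        then show False using c(1) by simp
      qed
      then show "r \<in> S" using r by (simp add: S_def)
    qed
    moreover have "0 \<in> S" "1 \<in> S" using a b by (simp_all add: S_def \<gamma>_def l_def)
    moreover have "(s + r) / 2 \<in> S" if "s \<in> S" "r \<in> S" for s r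
    proof -
      have I: "s \<in> {0..1}" "r \<in> {0..1}" "(s + r) / 2 \<in> {0..1}" using that by (auto simp: S_def)
      have "\<gamma> ((s + r) / 2) = (\<lambda>x. (\<gamma> s x + \<gamma> r x) / 2)"
        by (auto simp: \<gamma>_def field_simps)
      then have "E (\<gamma> ((s + r) / 2)) + E (\<gamma> ((s + r) / 2)) \<le> E (\<gamma> s) + E (\<gamma> r)"
        using mid[OF \<gamma>L \<gamma>L] by simp
      also have "\<dots> \<le> ennreal (l s) + ennreal (l r)"
        using that by (intro add_mono) (auto simp: S_def)
      also have "\<dots> = ennreal (l s + l r)"
        using l_nonneg I by (simp add: ennreal_plus)
      also have "l s + l r = 2 * l ((s + r) / 2)"
        by (simp add: l_def field_simps)
      finally have "E (\<gamma> ((s + r) / 2)) \<le> ennreal (l ((s + r) / 2))"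
        using l_nonneg[OF I(3)]
        by (cases "E (\<gamma> ((s + r) / 2))") (auto simp: top_unique simp flip: ennreal_plus)
      then show ?thesis using I(3) by (simp add: S_def)
    qed
    ultimately have "{0..1} \<subseteq> S" by (rule closed_midpoint_closed_unit_interval)
    then have "E (\<gamma> t) \<le> ennreal (l t)" using t by (auto simp: S_def)
    also have "ennreal (l t) = ennreal (1 - t) * E f + ennreal t * E g"
      using t a b by (simp add: l_def ennreal_mult ennreal_plus)
    finally show ?thesis by (simp add: \<gamma>_def)
  qed
qed

subsection \<open>The characterization\<close>

theorem theorem1p3:
  fixes M :: "'a measure" and E :: "('a \<Rightarrow> real) \<Rightarrow> ennreal"
  assumes "space M \<noteq> {}"
    and "sigma_finite_measure M"
    and "l2_lsc M E"
    and "l2_proper M E"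
    and "l2_convex M E \<Longrightarrow> gradient_flow_well_posed M E"
  shows "nonbilinear_dirichlet_form M E \<longleftrightarrow>
    (\<forall>f\<in>L2 M. \<forall>g\<in>L2 M. \<forall>\<alpha>\<ge>0.
       E (\<lambda>x. max (f x) (g x)) + E (\<lambda>x. min (f x) (g x)) \<le> E f + E g \<and>
       E (H \<alpha> f g) + E (H \<alpha> g f) \<le> E f + E g)"
proof -
  have *: "(\<forall>t\<ge>0. order_preserving_on_L2 M (semigroup M E t) \<and>
        linf_contraction_on_L2 M (semigroup M E t)) \<longleftrightarrow>
      truncation_contractive M E (\<lambda>d. max d 0) \<and>
      (\<forall>\<alpha>\<ge>0. truncation_contractive M E (soft_threshold \<alpha>))"
    if "l2_convex M E"
  proof -
    have wp: "gradient_flow_well_posed M E" using assms(5) that .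
    have E: "convex_l2_functional M E" using assms(3,4) that by unfold_locales
    have "truncation_contractive M E (\<lambda>d. max d 0) \<longleftrightarrow>
        (\<forall>t\<ge>0. order_preserving_on_L2 M (semigroup M E t))"
      unfolding truncated_functional.truncation_contractive_iff_semigroup_invariant
        [OF truncated_functional.intro[OF E soft_truncation_pos_part] wp]
      by (simp add: order_preserving_on_L2_def max_def)
    moreover have "(\<forall>\<alpha>\<ge>0. truncation_contractive M E (soft_threshold \<alpha>)) \<longleftrightarrow>
        (\<forall>t\<ge>0. linf_contraction_on_L2 M (semigroup M E t))"
    proof -
      \<comment> \<open>With \<open>P\<close> isolated, the two equivalences differ only in the
        order of the quantifiers over \<open>t\<close> and \<open>\<alpha>\<close>.\<close>
      define P where "P t \<alpha> \<longleftrightarrow> (\<forall>f\<in>L2 M. \<forall>g\<in>L2 M. (AE x in M. \<bar>f x - g x\<bar> \<le> \<alpha>) \<longrightarrow>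
          (AE x in M. \<bar>semigroup M E t f x - semigroup M E t g x\<bar> \<le> \<alpha>))" for t \<alpha>
      have "linf_contraction_on_L2 M (semigroup M E t) \<longleftrightarrow> (\<forall>\<alpha>\<ge>0. P t \<alpha>)" if "0 \<le> t" for t
        unfolding P_def
        by (intro linf_contraction_on_L2_iff gradient_flow_L2[OF semigroup_gradient_flow[OF wp]] that)
      moreover have "truncation_contractive M E (soft_threshold \<alpha>) \<longleftrightarrow> (\<forall>t\<ge>0. P t \<alpha>)"
        if "0 \<le> \<alpha>" for \<alpha>
        unfolding truncated_functional.truncation_contractive_iff_semigroup_invariant
          [OF truncated_functional.intro[OF E soft_truncation_soft_threshold[OF that]] wp]
          soft_threshold_eq_0_iff[OF that] P_def ..
      ultimately show ?thesis by auto
    qed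
    ultimately show ?thesis by blast
  qed
  \<comment> \<open>From right to left, convexity is obtained first, from the soft-threshold
    inequalities; it gives access to well-posedness and thus to the equivalence above.\<close>
  have "nonbilinear_dirichlet_form M E \<longleftrightarrow>
      truncation_contractive M E (\<lambda>d. max d 0) \<and>
      (\<forall>\<alpha>\<ge>0. truncation_contractive M E (soft_threshold \<alpha>))"
    using * midpoint_convex_imp_l2_convex[OF assms(3)]
      soft_threshold_contractive_imp_midpoint_convex[OF assms(3)] assms(3,4)
    unfolding nonbilinear_dirichlet_form_def by blast
  also have "\<dots> \<longleftrightarrow> (\<forall>f\<in>L2 M. \<forall>g\<in>L2 M. \<forall>\<alpha>\<ge>0.
       E (\<lambda>x. max (f x) (g x)) + E (\<lambda>x. min (f x) (g x)) \<le> E f + E g \<and>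
       E (H \<alpha> f g) + E (H \<alpha> g f) \<le> E f + E g)"
    using truncation_contractive_soft_threshold_iff[of _ M E]
    unfolding truncation_contractive_pos_part_iff by (meson order_refl)
  finally show ?thesis .
qed

end
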